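(* Let $\mathcal{A},\mathcal{B}$ be finite alphabets. Let $\varphi\colon \mathcal{A}\to\mathcal{A}^*$ be a primitive, left-proper substitution, let $M_{\varphi}$ denote the incidence matrix of $\varphi$, and let $s$ denote the size of the largest Jordan block of $M_{\varphi}$ corresponding to the eigenvalue $0$ (with $s=0$ if $0$ is not an eigenvalue of $M_\varphi$). Let $\tau\colon \mathcal{A}\to\mathcal{B}$ be a coding, let $x$ be a one-sided or an admissible two-sided fixed point of $\varphi$, let $y=\tau(x)$ and assume that $y$ is not periodic. The following conditions are equivalent: (i) $y$ is automatic; (ii) the row vector $(|\varphi^s(a)|)_{a\in\mathcal{A}}$ is a left eigenvector of $M_{\varphi}$.
   Context: For a finite alphabet $\mathcal{A}$, $\mathcal{A}^*$ is the set of finite words over $\mathcal{A}$ and $|u|$ is the length of a word $u$. One-sided sequences are elements of $\mathcal{A}^{\mathbf{N}}$, $\mathbf{N}=\{0,1,2,\dots\}$; two-sided sequences are elements of $\mathcal{A}^{\mathbf{Z}}$. A substitution is a map $\varphi\colon\mathcal{A}\to\mathcal{A}^*$, extended to words by concatenation and to sequences; on two-sided sequences $\varphi(\ldots x_{-1}.x_0\ldots)=\ldots\varphi(x_{-1}).\varphi(x_0)\ldots$, where the dot marks the position $0$. It has constant length $k$ if $|\varphi(b)|=k$ for all $b\in\mathcal{A}$. It is left-proper if all words $\varphi(b)$, $b\in\mathcal{A}$, share the same initial letter. A coding is a map $\mathcal{A}\to\mathcal{B}$, applied letterwise. A fixed point of $\varphi$ is a sequence $x$ with $\varphi(x)=x$;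 a two-sided fixed point $x$ is admissible if the word $x_{-1}x_0$ appears in $\varphi^n(b)$ for some $b\in\mathcal{A}$, $n\geq1$. The incidence matrix is $M_\varphi=(|\varphi(b)|_c)_{c,b\in\mathcal{A}}$ (row index $c$, column index $b$), where $|\varphi(b)|_c$ is the number of occurrences of $c$ in $\varphi(b)$. $\varphi$ is primitive if some power $M_\varphi^n$, $n\geq1$, has all entries strictly positive. For $k\geq2$, a (one-sided or two-sided) sequence is $k$-automatic if it is the image under a coding of a (one-sided, resp. two-sided) fixed point of a substitution of constant length $k$; it is automatic if it is $k$-automatic for some $k\geq2$. *)

theory Defs
  imports
    Complex_Main
    "HOL-Library.FuncSet"
    "HOL-Library.Sublist"
    "Jordan_Normal_Form.Jordan_Normal_Form_Uniqueness"
begin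

text \<open>
  One-sided sequences are functions on \<^typ>\<open>nat\<close>, two-sided sequences are functions on
  \<^typ>\<open>int\<close>. Notions common to both are defined for an index type \<open>'i\<close>, to be read as
  one of these two types.
\<close>

subsection \<open>Substitutions\<close>

definition substitution :: "'a set \<Rightarrow> ('a \<Rightarrow> 'a list) \<Rightarrow> bool" where
  "substitution A \<phi> \<longleftrightarrow> \<phi> \<in> A \<rightarrow> lists A"

definition subst_word :: "('a \<Rightarrow> 'a list) \<Rightarrow> 'a list \<Rightarrow> 'a list" where
  "subst_word \<phi> w = concat (map \<phi> w)"

definition constant_length :: "'a set \<Rightarrow> nat \<Rightarrow> ('a \<Rightarrow> 'a list) \<Rightarrow> bool" where
  "constant_length A k \<phi> \<longleftrightarrow> (\<forall>b\<in>A. length (\<phi> b) = k)"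

definition left_proper :: "'a set \<Rightarrow> ('a \<Rightarrow> 'a list) \<Rightarrow> bool" where
  "left_proper A \<phi> \<longleftrightarrow> (\<exists>c. \<forall>b\<in>A. \<phi> b \<noteq> [] \<and> hd (\<phi> b) = c)"

text \<open>
  \<open>subst_seq \<phi> x z\<close> says \<open>z = \<phi>(x)\<close>. Here \<open>pos i\<close> is the position at which the
  block \<open>\<phi> (x i)\<close> starts: \<open>pos i = (\<Sum>l<i. length (\<phi> (x l)))\<close> for \<open>i \<ge> 0\<close>, and
  minus the total length of the blocks \<open>i, \<dots>, -1\<close> for \<open>i < 0\<close>; the two equations
  determine \<open>pos\<close> both on \<^typ>\<open>nat\<close> and on \<^typ>\<open>int\<close>. Every position lies in exactly
  one block. It is a relation, since \<open>\<phi>(x)\<close> need not be an infinite sequence if \<open>\<phi>\<close> is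
  erasing; in that case it holds for no \<open>z\<close>.
\<close>

definition subst_seq :: "('a \<Rightarrow> 'a list) \<Rightarrow> ('i :: semiring_1 \<Rightarrow> 'a) \<Rightarrow> ('i \<Rightarrow> 'a) \<Rightarrow> bool" where
  "subst_seq \<phi> x z \<longleftrightarrow>
     (\<exists>pos. pos 0 = 0 \<and>
            (\<forall>i. pos (i + 1) = pos i + of_nat (length (\<phi> (x i)))) \<and>
            (\<forall>n. \<exists>i. \<exists>j < length (\<phi> (x i)). n = pos i + of_nat j \<and> z n = \<phi> (x i) ! j))"

definition fixed_point :: "'a set \<Rightarrow> ('a \<Rightarrow> 'a list) \<Rightarrow> ('i :: semiring_1 \<Rightarrow> 'a) \<Rightarrow> bool" where
  "fixed_point A \<phi> x \<longleftrightarrow> range x \<subseteq> A \<and> subst_seq \<phi> x x"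

definition admissible :: "'a set \<Rightarrow> ('a \<Rightarrow> 'a list) \<Rightarrow> (int \<Rightarrow> 'a) \<Rightarrow> bool" where
  "admissible A \<phi> x \<longleftrightarrow>
     (\<exists>b\<in>A. \<exists>n\<ge>1. sublist [x (-1), x 0] ((subst_word \<phi> ^^ n) [b]))"

subsection \<open>Periodic and automatic sequences\<close>

definition periodic :: "('i :: linordered_semidom \<Rightarrow> 'b) \<Rightarrow> bool" where
  "periodic y \<longleftrightarrow> (\<exists>p>0. \<forall>n. y (n + p) = y n)"

text \<open>
  The alphabet of the constant length substitution is existentially quantified; as it is
  finite, it may be taken to be a set of natural numbers.
\<close>

definition k_automatic :: "nat \<Rightarrow> ('i :: semiring_1 \<Rightarrow> 'b) \<Rightarrow> bool" where
  "k_automatic k y \<longleftrightarrow>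
     (\<exists>(C :: nat set) \<psi> \<pi> z. finite C \<and> substitution C \<psi> \<and> constant_length C k \<psi> \<and>
        fixed_point C \<psi> z \<and> y = \<pi> \<circ> z)"

definition automatic :: "('i :: semiring_1 \<Rightarrow> 'b) \<Rightarrow> bool" where
  "automatic y \<longleftrightarrow> (\<exists>k\<ge>2. k_automatic k y)"

subsection \<open>Incidence matrices\<close>

text \<open>
  Matrices are indexed by natural numbers, so vectors and matrices indexed by an alphabet
  are formed along a list \<open>ls\<close> enumerating its letters without repetition.
\<close>

definition incidence_mat :: "'a list \<Rightarrow> ('a \<Rightarrow> 'a list) \<Rightarrow> 'r :: semiring_1 mat" where
  "incidence_mat ls \<phi> =
     mat (length ls) (length ls) (\<lambda>(i, j). of_nat (count_list (\<phi> (ls ! j)) (ls ! i)))"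

definition primitive :: "'a list \<Rightarrow> ('a \<Rightarrow> 'a list) \<Rightarrow> bool" where
  "primitive ls \<phi> \<longleftrightarrow>
     (\<exists>n\<ge>1. \<forall>i<length ls. \<forall>j<length ls. ((incidence_mat ls \<phi> :: nat mat) ^\<^sub>m n) $$ (i, j) > 0)"

definition length_vec :: "'a list \<Rightarrow> ('a \<Rightarrow> 'a list) \<Rightarrow> nat \<Rightarrow> 'r :: semiring_1 vec" where
  "length_vec ls \<phi> s = vec (length ls) (\<lambda>i. of_nat (length ((subst_word \<phi> ^^ s) [ls ! i])))"

text \<open>\<open>v M = \<lambda> v\<close> for the row vector \<open>v\<close>, expressed through the transpose of \<open>M\<close>.\<close>

definition left_eigenvector :: "'r :: comm_ring_1 mat \<Rightarrow> 'r vec \<Rightarrow> bool" where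
  "left_eigenvector M v \<longleftrightarrow> (\<exists>ev. eigenvector (transpose_mat M) v ev)"

text \<open>The value is \<open>0\<close> if there is no Jordan block for \<open>ev\<close>.\<close>

definition max_jordan_block :: "complex mat \<Rightarrow> complex \<Rightarrow> nat" where
  "max_jordan_block M ev = Max (insert 0 {n. \<exists>n_as. jordan_nf M n_as \<and> (n, ev) \<in> set n_as})"

lemma max_jordan_block_eq:
  assumes "jordan_nf M n_as"
  shows "max_jordan_block M ev = Max (insert 0 {n. (n, ev) \<in> set n_as})"
proof -
  have "{n. \<exists>m_bs. jordan_nf M m_bs \<and> (n, ev) \<in> set m_bs} = {n. (n, ev) \<in> set n_as}"
    using assms jordan_nf_unique[OF assms] by blast
  then show ?thesis by (simp add: max_jordan_block_def)
qed

end

theory Submission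
  imports Defs "Jordan_Normal_Form.Jordan_Normal_Form_Existence"
begin

text \<open>
  Condition (ii) says that \<open>|\<phi>\<^sup>s\<^sup>+\<^sup>1(a)| = k |\<phi>\<^sup>s(a)|\<close> for all letters \<open>a\<close>. By primitivity and the
  choice of \<open>s\<close> it suffices to have two proportional vectors among the \<open>(|\<phi>\<^sup>n(a)|)\<^sub>a\<close>. If (ii) holds,
  \<open>k\<close> is an integer, and Dekking's construction exhibits \<open>x\<close> as a coding of a fixed point of a
  substitution of constant length \<open>k\<close>.

  Conversely, let \<open>y = \<tau>(x)\<close> be a coding of a fixed point of \<open>\<psi>\<close> of constant length \<open>k\<close>. As \<open>y\<close>
  contains no high powers, the occurrences in \<open>y\<close> of a word of length comparable with \<open>k\<^sup>m\<close> lie in one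
  residue class modulo some \<open>g\<^sub>m\<close> with \<open>k\<^sup>m / g\<^sub>m\<close> bounded. As \<open>\<phi>\<close> is left-proper, the word
  \<open>\<tau>(\<phi>\<^sup>n(c))\<close>, with \<open>c\<close> the common initial letter, recurs at distance \<open>|\<phi>\<^sup>n\<^sup>+\<^sup>1(a)|\<close> for every \<open>a\<close>.
  Choosing \<open>m\<close> suitably, the integer vectors \<open>(|\<phi>\<^sup>n\<^sup>+\<^sup>1(a)| / g\<^sub>m)\<^sub>a\<close> are bounded, so two of them agree.
\<close>

subsection \<open>Jordan blocks for the eigenvalue 0\<close>

text \<open>The obstacle is uniformity: the pigeonhole needs a bound on \<open>k ^ m / g\<close>
  that does not depend on the scale \<open>m\<close>. Two facts provide it. How two decompositions
  into blocks of length \<open>N\<close> overlap at offset \<open>r\<close> is recorded by a set of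
  triples of letters, and there are finitely many such sets whatever \<open>N\<close> is; so one
  number \<open>T\<close> of blocks decides at every scale whether a coincidence extends
  indefinitely. The offsets that do extend are closed under addition, hence the multiples of one
  \<open>g\<close>, and too small a \<open>g\<close> would force a high power in \<open>y\<close>.

  As \<psi> need not be primitive, this runs in a minimal sublanguage of the language of its fixed
  point. Nothing is lost: \<phi> is primitive, so every factor of \<open>x\<close> recurs in all
  long windows, in particular in those coming from words of the sublanguage.

  The pigeonhole yields proportional length vectors at two indices that may be far apart. A
  Perron-Frobenius argument makes the indices consecutive, and the kernels of the powers of the
  transposed incidence matrix, which stop growing at \<open>s\<close>, move the index to
  \<open>s\<close>.\<close>

lemma pow_mat_add:
  fixes A :: "'r :: semiring_1 mat"
  assumes "A \<in> carrier_mat n n"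
  shows "A ^\<^sub>m (i + j) = A ^\<^sub>m i * A ^\<^sub>m j"
  using assms
  by (induction j) (simp_all add: assoc_mult_mat[of _ n n _ n _ n, symmetric] pow_carrier_mat)

text \<open>A nilpotent block has vanishing powers from its size on, so both sides are 0. A block
  with \<open>a \<noteq> 0\<close> is triangular with nonzero diagonal, hence invertible, and
  \<open>Y\<close> is the inverse of its power \<open>d\<close>.\<close>

lemma jordan_block_pow_stabilizes:
  fixes a :: complex
  assumes "a = 0 \<Longrightarrow> n \<le> s"
  shows "\<exists>Y \<in> carrier_mat n n. jordan_block n a ^\<^sub>m s = jordan_block n a ^\<^sub>m (s + d) * Y"
proof (cases "a = 0")
  case True
  then have "n \<le> s" using assms by simp
  have z: "jordan_block n (0::complex) ^\<^sub>m k = 0\<^sub>m n n" if "n \<le> k" for k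
    unfolding jordan_block_zero_pow using that by (intro eq_matI) auto
  have e: "jordan_block n a ^\<^sub>m s = 0\<^sub>m n n" "jordan_block n a ^\<^sub>m (s + d) = 0\<^sub>m n n"
    using z[of s] z[of "s+d"] True \<open>n \<le> s\<close> by auto
  show ?thesis unfolding e by (rule bexI[of _ "0\<^sub>m n n"]) auto
next
  case False
  let ?J = "jordan_block n a"
  have c: "?J \<in> carrier_mat n n" by simp
  have "upper_triangular ?J" by auto
  then have "det ?J = prod_list (diag_mat ?J)"
    by (rule det_upper_triangular[OF _ c])
  also have "diag_mat ?J = replicate n a"
    by (auto simp: diag_mat_def intro!: nth_equalityI)
  finally have "det ?J \<noteq> 0" using False by simp
  then have "det (?J ^\<^sub>m d) \<noteq> 0"
    by (induction d) (simp_all add: det_mult[of _ n])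
  moreover have "?J ^\<^sub>m d \<in> carrier_mat n n" by simp
  ultimately have "?J ^\<^sub>m d \<in> Units (ring_mat TYPE(complex) n ())"
    by (rule det_non_zero_imp_unit[rotated])
  then obtain Y where Y: "Y \<in> carrier_mat n n" "?J ^\<^sub>m d * Y = 1\<^sub>m n"
    by (auto simp: Units_def ring_mat_def)
  have "?J ^\<^sub>m (s + d) * Y = ?J ^\<^sub>m s * (?J ^\<^sub>m d * Y)"
    using Y(1) by (simp add: pow_mat_add[OF c] assoc_mult_mat[of _ n n _ n _ n])
  also have "\<dots> = ?J ^\<^sub>m s" using Y by simp
  finally show ?thesis using Y(1) by metis
qed

lemma jordan_matrix_pow_stabilizes:
  fixes n_as :: "(nat \<times> complex) list"
  assumes "\<And>n. (n, 0) \<in> set n_as \<Longrightarrow> n \<le> s"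
  shows "\<exists>Y \<in> carrier_mat (sum_list (map fst n_as)) (sum_list (map fst n_as)).
           jordan_matrix n_as ^\<^sub>m s = jordan_matrix n_as ^\<^sub>m (s + d) * Y"
  using assms
proof (induction n_as)
  case Nil
  show ?case by (rule bexI[of _ "1\<^sub>m 0"]) (auto intro!: eq_matI)
next
  case (Cons na n_as)
  obtain n a where na: "na = (n, a)" by force
  let ?N = "sum_list (map fst n_as)"
  let ?B = "jordan_block n a" and ?J = "jordan_matrix n_as"
  have cB: "?B \<in> carrier_mat n n" and cJ: "?J \<in> carrier_mat ?N ?N" by simp_all
  from Cons obtain Y where Y: "Y \<in> carrier_mat ?N ?N" "?J ^\<^sub>m s = ?J ^\<^sub>m (s + d) * Y" by auto
  obtain X where X: "X \<in> carrier_mat n n" "?B ^\<^sub>m s = ?B ^\<^sub>m (s + d) * X"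
    using jordan_block_pow_stabilizes[of a n s d] Cons.prems na by auto
  let ?Z = "four_block_mat X (0\<^sub>m n ?N) (0\<^sub>m ?N n) Y"
  have pw: "jordan_matrix (na # n_as) ^\<^sub>m k
      = four_block_mat (?B ^\<^sub>m k) (0\<^sub>m n ?N) (0\<^sub>m ?N n) (?J ^\<^sub>m k)" for k
    unfolding na jordan_matrix_Cons by (rule pow_four_block_mat[OF cB cJ])
  have pJ: "?J ^\<^sub>m k \<in> carrier_mat ?N ?N" for k by (rule pow_carrier_mat[OF cJ])
  have "jordan_matrix (na # n_as) ^\<^sub>m (s + d) * ?Z
      = four_block_mat (?B ^\<^sub>m (s + d) * X) (0\<^sub>m n ?N) (0\<^sub>m ?N n) (?J ^\<^sub>m (s + d) * Y)"
    unfolding pw using X(1) Y(1) pJ[of "s+d"]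
    by (subst mult_four_block_mat[of _ n n _ ?N _ ?N _ _ n _ ?N]) auto
  also have "\<dots> = jordan_matrix (na # n_as) ^\<^sub>m s" unfolding pw X(2) Y(2) ..
  finally show ?case using X(1) Y(1) na by (intro bexI[of _ ?Z]) auto
qed

text \<open>Read for the transpose: a vector killed by the power \<open>?s + d\<close> is already
  killed by the power \<open>?s\<close>. The Jordan form exists because the characteristic
  polynomial splits over the complex numbers; conjugation carries the identity from the Jordan
  matrix to \<open>M\<close>.\<close>

lemma max_jordan_block_stabilizes:
  fixes M :: "complex mat"
  assumes M: "M \<in> carrier_mat n n"
  shows "\<exists>X \<in> carrier_mat n n. M ^\<^sub>m (max_jordan_block M 0) = M ^\<^sub>m (max_jordan_block M 0 + d) * X"
proof -
  let ?s = "max_jordan_block M 0"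
  obtain n_as where jnf: "jordan_nf M n_as"
    using char_poly_factorized[OF M] jordan_nf_exists[OF M] by blast
  let ?J = "jordan_matrix n_as"
  have fin: "finite {k. (k, 0) \<in> set n_as}"
    by (rule finite_subset[of _ "fst ` set n_as"]) force+
  have le: "k \<le> ?s" if "(k, 0) \<in> set n_as" for k
    unfolding max_jordan_block_eq[OF jnf] using fin that by (intro Max_ge) auto
  from jnf obtain P Q where PQ: "similar_mat_wit M ?J P Q"
    unfolding jordan_nf_def similar_mat_def by auto
  note c = similar_mat_witD2(5,6,7,2)[OF M PQ]
  have N: "sum_list (map fst n_as) = n" using c(1) jordan_matrix_dim(1)[of n_as] by auto
  obtain Y where Y: "Y \<in> carrier_mat n n" "?J ^\<^sub>m ?s = ?J ^\<^sub>m (?s + d) * Y"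
    using jordan_matrix_pow_stabilizes[of n_as ?s d] le N by auto
  have pw: "M ^\<^sub>m k = P * ?J ^\<^sub>m k * Q" for k
    by (rule similar_mat_wit_pow_id[OF PQ])
  have cJ: "?J ^\<^sub>m k \<in> carrier_mat n n" for k by (rule pow_carrier_mat[OF c(1)])
  note simps = assoc_mult_mat[of _ n n _ n _ n] mult_carrier_mat[of _ n n _ n] cJ c(2,3) Y(1)
  have "M ^\<^sub>m (?s + d) * (P * Y * Q) = P * ?J ^\<^sub>m (?s + d) * ((Q * P) * (Y * Q))"
    unfolding pw by (simp only: simps)
  also have "\<dots> = P * (?J ^\<^sub>m (?s + d) * Y) * Q"
    unfolding c(4) left_mult_one_mat[OF mult_carrier_mat[OF Y(1) c(3)]] by (simp only: simps)
  also have "\<dots> = M ^\<^sub>m ?s" unfolding pw Y(2) ..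
  finally have "M ^\<^sub>m ?s = M ^\<^sub>m (?s + d) * (P * Y * Q)" ..
  moreover have "P * Y * Q \<in> carrier_mat n n"
    using mult_carrier_mat[OF mult_carrier_mat[OF c(2) Y(1)] c(3)] .
  ultimately show ?thesis by blast
qed

subsection \<open>Incidence matrices and lengths\<close>

lemma subst_word_append [simp]: "subst_word \<phi> (u @ v) = subst_word \<phi> u @ subst_word \<phi> v"
  by (simp add: subst_word_def)

lemma subst_word_Nil [simp]: "subst_word \<phi> [] = []"
  by (simp add: subst_word_def)

lemma subst_word_pow_append [simp]:
  "(subst_word \<phi> ^^ n) (u @ v) = (subst_word \<phi> ^^ n) u @ (subst_word \<phi> ^^ n) v"
  by (induction n) auto

lemma subst_word_pow_Nil [simp]: "(subst_word \<phi> ^^ n) [] = []"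
  by (induction n) auto

lemma subst_word_pow_eq_concat:
  "(subst_word \<phi> ^^ n) u = concat (map (\<lambda>a. (subst_word \<phi> ^^ n) [a]) u)"
proof (induction u)
  case (Cons a u)
  then show ?case using subst_word_pow_append[of n \<phi> "[a]" u] by simp
qed simp

abbreviation iter_length :: "('a \<Rightarrow> 'a list) \<Rightarrow> nat \<Rightarrow> 'a \<Rightarrow> nat" where
  "iter_length \<phi> n a \<equiv> length ((subst_word \<phi> ^^ n) [a])"

lemma length_subst_word_pow:
  "length ((subst_word \<phi> ^^ n) u) = (\<Sum>a\<leftarrow>u. iter_length \<phi> n a)"
  by (subst subst_word_pow_eq_concat) (simp add: length_concat o_def)

lemma subst_word_pow_Suc: "(subst_word \<phi> ^^ Suc n) [a] = (subst_word \<phi> ^^ n) (\<phi> a)"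
proof -
  have "(subst_word \<phi> ^^ Suc n) [a] = (subst_word \<phi> ^^ n) (subst_word \<phi> [a])"
    by (simp only: funpow_Suc_right o_apply)
  then show ?thesis by (simp add: subst_word_def)
qed

lemma sum_list_map_eq_sum_count_nth:
  fixes f :: "'a \<Rightarrow> nat"
  assumes "distinct ls" "set w \<subseteq> set ls"
  shows "(\<Sum>a\<leftarrow>w. f a) = (\<Sum>i<length ls. count_list w (ls ! i) * f (ls ! i))"
proof -
  have "(\<Sum>a\<leftarrow>w. f a) = (\<Sum>a\<in>set ls. count_list w a * f a)"
    using assms(2) sum_list_map_eq_sum_count2[of w "set ls" f] by simp
  also have "\<dots> = (\<Sum>i<length ls. count_list w (ls ! i) * f (ls ! i))"
    using sum.reindex_bij_betw[OF bij_betw_nth[OF assms(1) refl refl], of "\<lambda>a. count_list w a * f a"]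
    by simp
  finally show ?thesis .
qed

context
  fixes ls :: "'a list" and \<phi> :: "'a \<Rightarrow> 'a list"
  assumes dist: "distinct ls" and subst: "substitution (set ls) \<phi>"
begin

lemma set_subst_letter: "a \<in> set ls \<Longrightarrow> set (\<phi> a) \<subseteq> set ls"
  using subst by (auto simp: substitution_def)

text \<open>The length of \<open>\<phi>\<^sup>n\<^sup>+\<^sup>1(a)\<close> is the sum of the lengths
  of \<open>\<phi>\<^sup>n(b)\<close> over the letters \<open>b\<close> of \<phi>(a). This turns the
  eigenvector condition into proportionality of consecutive length vectors.\<close>

lemma transpose_incidence_mult_length_vec:
  "transpose_mat (incidence_mat ls \<phi>) *\<^sub>v length_vec ls \<phi> n = (length_vec ls \<phi> (Suc n) :: 'r :: comm_semiring_1 vec)"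
proof (rule eq_vecI)
  fix j assume "j < dim_vec (length_vec ls \<phi> (Suc n) :: 'r vec)"
  then have j: "j < length ls" by (simp add: length_vec_def)
  have w: "set (\<phi> (ls ! j)) \<subseteq> set ls" using j by (intro set_subst_letter) simp
  have "(transpose_mat (incidence_mat ls \<phi>) *\<^sub>v length_vec ls \<phi> n) $ j
      = (\<Sum>i<length ls. of_nat (count_list (\<phi> (ls ! j)) (ls ! i)) * of_nat (iter_length \<phi> n (ls ! i)))"
    using j by (simp add: incidence_mat_def length_vec_def scalar_prod_def atLeast0LessThan)
  also have "\<dots> = of_nat (iter_length \<phi> (Suc n) (ls ! j))"
    unfolding subst_word_pow_Suc length_subst_word_pow[of n \<phi> "\<phi> (ls ! j)"]
      sum_list_map_eq_sum_count_nth[OF dist w] by simp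
  finally show "(transpose_mat (incidence_mat ls \<phi>) *\<^sub>v length_vec ls \<phi> n) $ j
      = (length_vec ls \<phi> (Suc n) :: 'r vec) $ j"
    using j by (simp add: length_vec_def)
qed (simp add: length_vec_def incidence_mat_def)

lemma count_subst_word_pow:
  assumes "i < length ls" "j < length ls"
  shows "((incidence_mat ls \<phi> :: nat mat) ^\<^sub>m n) $$ (i, j) = count_list ((subst_word \<phi> ^^ n) [ls ! j]) (ls ! i)"
  using assms
proof (induction n arbitrary: i j)
  case 0
  then show ?case using dist by (auto simp: incidence_mat_def nth_eq_iff_index_eq)
next
  case (Suc n)
  let ?M = "incidence_mat ls \<phi> :: nat mat"
  have c: "?M \<in> carrier_mat (length ls) (length ls)" by (simp add: incidence_mat_def)
  have w: "set (\<phi> (ls ! j)) \<subseteq> set ls" using Suc.prems by (intro set_subst_letter) simp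
  have cl: "count_list (concat ws) b = (\<Sum>u\<leftarrow>ws. count_list u b)" for ws :: "'a list list" and b
    by (induction ws) auto
  have "(?M ^\<^sub>m Suc n) $$ (i, j) = row (?M ^\<^sub>m n) i \<bullet> col ?M j"
    using Suc.prems c by (simp add: pow_carrier_mat[OF c])
  also have "\<dots> = (\<Sum>l<length ls. (?M ^\<^sub>m n) $$ (i, l) * count_list (\<phi> (ls ! j)) (ls ! l))"
    using Suc.prems c
    by (simp add: scalar_prod_def atLeast0LessThan incidence_mat_def)
  also have "\<dots> = (\<Sum>l<length ls. count_list (\<phi> (ls ! j)) (ls ! l) * count_list ((subst_word \<phi> ^^ n) [ls ! l]) (ls ! i))"
    using Suc by (intro sum.cong) auto
  also have "\<dots> = (\<Sum>a\<leftarrow>\<phi> (ls ! j). count_list ((subst_word \<phi> ^^ n) [a]) (ls ! i))"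
    by (rule sum_list_map_eq_sum_count_nth[OF dist w, symmetric])
  also have "\<dots> = count_list ((subst_word \<phi> ^^ n) (\<phi> (ls ! j))) (ls ! i)"
    by (subst (2) subst_word_pow_eq_concat) (simp add: cl o_def)
  finally show ?case unfolding subst_word_pow_Suc .
qed

lemma primitive_imp_all_letters:
  assumes "primitive ls \<phi>"
  shows "\<exists>n\<ge>1. \<forall>a\<in>set ls. set ls \<subseteq> set ((subst_word \<phi> ^^ n) [a])"
proof -
  obtain n where n: "n \<ge> 1" "\<forall>i<length ls. \<forall>j<length ls. ((incidence_mat ls \<phi> :: nat mat) ^\<^sub>m n) $$ (i, j) > 0"
    using assms unfolding primitive_def by blast
  have "b \<in> set ((subst_word \<phi> ^^ n) [a])" if ab: "a \<in> set ls" "b \<in> set ls" for a b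
  proof -
    obtain i j where ij: "i < length ls" "j < length ls" "b = ls ! i" "a = ls ! j"
      using ab by (metis in_set_conv_nth)
    then have "0 < count_list ((subst_word \<phi> ^^ n) [a]) b"
      using n(2)[rule_format, of i j] count_subst_word_pow[of i j n] by simp
    then show ?thesis by (metis count_notin less_irrefl)
  qed
  then show ?thesis using n(1) by blast
qed

text \<open>With \<open>?v n\<close> the length vectors,
  \<open>?v (Suc n) = \<mu> \<cdot>\<^sub>v ?v n\<close> says that the one vector
  \<open>?v 1 - \<mu> \<cdot>\<^sub>v ?v 0\<close> is killed by the power \<open>n\<close> of the
  transpose. As the kernels stop growing at \<open>s\<close>, proportionality at any index
  \<open>n\<close> passes to \<open>s\<close>. The cross-multiplied form eliminates the eigenvalue
  and stays in the natural numbers.\<close>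

lemma left_eigenvector_length_vec_iff:
  assumes "ls \<noteq> []" "\<forall>a\<in>set ls. \<phi> a \<noteq> []"
    and s: "s = max_jordan_block (incidence_mat ls \<phi>) 0"
  shows "left_eigenvector (incidence_mat ls \<phi>) (length_vec ls \<phi> s :: complex vec) \<longleftrightarrow>
    (\<forall>a\<in>set ls. \<forall>b\<in>set ls. iter_length \<phi> (Suc s) a * iter_length \<phi> s b = iter_length \<phi> (Suc s) b * iter_length \<phi> s a)"
    (is "?l \<longleftrightarrow> ?p s")
    and "(\<forall>a\<in>set ls. \<forall>b\<in>set ls. iter_length \<phi> (Suc n) a * iter_length \<phi> n b = iter_length \<phi> (Suc n) b * iter_length \<phi> n a)
      \<Longrightarrow> left_eigenvector (incidence_mat ls \<phi>) (length_vec ls \<phi> s :: complex vec)"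
proof -
  let ?M = "incidence_mat ls \<phi> :: complex mat" and ?n = "length ls"
  let ?v = "\<lambda>n. length_vec ls \<phi> n :: complex vec"
  have M: "?M \<in> carrier_mat ?n ?n" by (simp add: incidence_mat_def)
  have v: "?v k \<in> carrier_vec ?n" for k by (simp add: length_vec_def)
  have ne: "(subst_word \<phi> ^^ k) w \<noteq> []" if "w \<noteq> []" "set w \<subseteq> set ls" for k w
    using that
  proof (induction k arbitrary: w)
    case (Suc k)
    have "subst_word \<phi> w \<noteq> []" using Suc.prems assms(2) by (auto simp: subst_word_def neq_Nil_conv)
    moreover have "set (subst_word \<phi> w) \<subseteq> set ls"
      using Suc.prems set_subst_letter by (fastforce simp: subst_word_def)
    ultimately show ?case using Suc.IH by (simp only: funpow_Suc_right o_apply)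
  qed simp
  have L: "iter_length \<phi> k a > 0" if "a \<in> set ls" for k a using ne[of "[a]" k] that by simp
  have v0: "?v k \<noteq> 0\<^sub>v ?n" for k
  proof
    assume "?v k = 0\<^sub>v ?n"
    then have "?v k $ 0 = 0" using assms(1) by simp
    then show False using L[of "ls ! 0" k] assms(1) by (simp add: length_vec_def)
  qed
  have pw: "transpose_mat (?M ^\<^sub>m k) *\<^sub>v ?v m = ?v (m + k)" for k m
  proof (induction k arbitrary: m)
    case 0 then show ?case using v M by (simp add: transpose_one)
  next
    case (Suc k)
    have "transpose_mat (?M ^\<^sub>m Suc k) *\<^sub>v ?v m = transpose_mat ?M *\<^sub>v (transpose_mat (?M ^\<^sub>m k) *\<^sub>v ?v m)"
      using M v pow_carrier_mat[OF M, of k]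
      by (simp add: transpose_mult[OF pow_carrier_mat[OF M] M] assoc_mult_mat_vec[of _ ?n ?n _ ?n])
    also have "\<dots> = ?v (m + Suc k)" unfolding Suc transpose_incidence_mult_length_vec by simp
    finally show ?case .
  qed
  have ev: "?v (Suc n) = \<mu> \<cdot>\<^sub>v ?v n \<longleftrightarrow> transpose_mat (?M ^\<^sub>m n) *\<^sub>v (?v 1 - \<mu> \<cdot>\<^sub>v ?v 0) = 0\<^sub>v ?n" for n \<mu>
  proof -
    have "transpose_mat (?M ^\<^sub>m n) *\<^sub>v (?v 1 - \<mu> \<cdot>\<^sub>v ?v 0) = ?v (Suc n) - \<mu> \<cdot>\<^sub>v ?v n"
      using v pow_carrier_mat[OF M, of n] pw[of n 0] pw[of n 1]
      by (simp add: mult_minus_distrib_mat_vec[of _ ?n ?n] mult_mat_vec[of _ ?n ?n])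
    also have "\<dots> = 0\<^sub>v ?n \<longleftrightarrow> ?v (Suc n) = \<mu> \<cdot>\<^sub>v ?v n"
      using v[of n] v[of "Suc n"]
      by (auto simp: vec_eq_iff)
    finally show ?thesis by simp
  qed
  have proportional: "(\<exists>\<mu>. ?v (Suc n) = \<mu> \<cdot>\<^sub>v ?v n) \<longleftrightarrow> ?p n" for n
  proof
    assume "\<exists>\<mu>. ?v (Suc n) = \<mu> \<cdot>\<^sub>v ?v n"
    then obtain \<mu> where e: "?v (Suc n) = \<mu> \<cdot>\<^sub>v ?v n" ..
    have l: "of_nat (iter_length \<phi> (Suc n) a) = \<mu> * of_nat (iter_length \<phi> n a)" if a: "a \<in> set ls" for a
    proof -
      obtain i where "i < ?n" "a = ls ! i" using a by (metis in_set_conv_nth)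
      then show ?thesis using arg_cong[OF e, of "\<lambda>w. w $ i"] by (simp add: length_vec_def)
    qed
    show "?p n"
    proof (intro ballI)
      fix a b assume "a \<in> set ls" "b \<in> set ls"
      then have "complex_of_nat (iter_length \<phi> (Suc n) a) * of_nat (iter_length \<phi> n b)
          = of_nat (iter_length \<phi> (Suc n) b) * of_nat (iter_length \<phi> n a)"
        by (simp only: l mult_ac)
      then show "iter_length \<phi> (Suc n) a * iter_length \<phi> n b = iter_length \<phi> (Suc n) b * iter_length \<phi> n a"
        by (simp only: of_nat_mult[symmetric] of_nat_eq_iff)
    qed
  next
    assume p: "?p n"
    define b where "b = ls ! 0"
    have b: "b \<in> set ls" using assms(1) by (simp add: b_def)
    let ?\<mu> = "complex_of_nat (iter_length \<phi> (Suc n) b) / of_nat (iter_length \<phi> n b)"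
    have "of_nat (iter_length \<phi> (Suc n) a) = ?\<mu> * of_nat (iter_length \<phi> n a)" if a: "a \<in> set ls" for a
    proof -
      have "complex_of_nat (iter_length \<phi> (Suc n) a) * of_nat (iter_length \<phi> n b)
          = of_nat (iter_length \<phi> (Suc n) b) * of_nat (iter_length \<phi> n a)"
        using p[rule_format, OF a b] by (simp only: of_nat_mult[symmetric] of_nat_eq_iff)
      then show ?thesis using L[OF b, of n] by (simp add: field_simps del: funpow.simps)
    qed
    then show "\<exists>\<mu>. ?v (Suc n) = \<mu> \<cdot>\<^sub>v ?v n"
      by (intro exI[of _ ?\<mu>] eq_vecI) (auto simp: length_vec_def simp del: funpow.simps)
  qed
  have le: "?l \<longleftrightarrow> (\<exists>\<mu>. ?v (Suc s) = \<mu> \<cdot>\<^sub>v ?v s)"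
    unfolding left_eigenvector_def eigenvector_def transpose_incidence_mult_length_vec
    using v v0[of s] M by auto
  show "?l \<longleftrightarrow> ?p s" unfolding le proportional ..
  assume "?p n"
  then obtain \<mu> where "?v (Suc n) = \<mu> \<cdot>\<^sub>v ?v n" using proportional by blast
  then have w0: "transpose_mat (?M ^\<^sub>m n) *\<^sub>v (?v 1 - \<mu> \<cdot>\<^sub>v ?v 0) = 0\<^sub>v ?n" using ev by simp
  \<comment> \<open>The exponent \<open>s + n\<close> treats \<open>n \<le> s\<close> and
    \<open>n > s\<close> at once: it contains \<open>n\<close>, so the vector is killed, and it
    reduces to \<open>s\<close>.\<close>
  obtain X where X: "X \<in> carrier_mat ?n ?n" "?M ^\<^sub>m s = ?M ^\<^sub>m (s + n) * X"
    using max_jordan_block_stabilizes[OF M] s by blast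
  let ?w = "?v 1 - \<mu> \<cdot>\<^sub>v ?v 0"
  have w: "?w \<in> carrier_vec ?n" using v by simp
  note cM = pow_carrier_mat[OF M]
  have B: "?M ^\<^sub>m s * X \<in> carrier_mat ?n ?n" by (rule mult_carrier_mat[OF cM X(1)])
  have "?M ^\<^sub>m s = ?M ^\<^sub>m n * (?M ^\<^sub>m s * X)"
    using X(1) cM pow_mat_add[OF M, of n s] assoc_mult_mat[OF cM[of n] cM[of s] X(1)]
    by (subst X(2)) (simp add: add.commute[of s n])
  then have "transpose_mat (?M ^\<^sub>m s) *\<^sub>v ?w
      = transpose_mat (?M ^\<^sub>m s * X) *\<^sub>v (transpose_mat (?M ^\<^sub>m n) *\<^sub>v ?w)"
    using transpose_mult[OF cM[of n] B]
      assoc_mult_mat_vec[OF transpose_carrier_mat[THEN iffD2, OF B] transpose_carrier_mat[THEN iffD2, OF cM[of n]] w]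
    by simp
  also have "\<dots> = 0\<^sub>v ?n" unfolding w0
    using carrier_matD[OF B] by (intro eq_vecI) (simp_all add: scalar_prod_def)
  finally show ?l using ev le by blast
qed

end

subsection \<open>Recognizability for uniform block codings\<close>

text \<open>The language of a subshift. Working with words instead of sequences treats one-sided and
  two-sided sequences alike; words of every length express that the subshift is nonempty.\<close>

definition language :: "'c set \<Rightarrow> 'c list set \<Rightarrow> bool" where
  "language C D \<longleftrightarrow> D \<subseteq> lists C \<and> (\<forall>u\<in>D. \<forall>v. sublist v u \<longrightarrow> v \<in> D) \<and> (\<forall>n. \<exists>u\<in>D. length u = n)"

definition uniformly_recurrent :: "'c list set \<Rightarrow> bool" where
  "uniformly_recurrent D \<longleftrightarrow> (\<forall>u\<in>D. \<exists>n. \<forall>w\<in>D. n \<le> length w \<longrightarrow> sublist u w)"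

lemma language_sublist: "language C D \<Longrightarrow> u \<in> D \<Longrightarrow> sublist v u \<Longrightarrow> v \<in> D"
  by (auto simp: language_def)

lemma language_take_drop: "language C D \<Longrightarrow> u \<in> D \<Longrightarrow> take m (drop n u) \<in> D"
  using language_sublist sublist_take sublist_drop by (metis sublist_order.order_trans)

lemma language_letters: "language C D \<Longrightarrow> u \<in> D \<Longrightarrow> set u \<subseteq> C"
  by (auto simp: language_def)

text \<open>Existence of a minimal subshift. Zorn's lemma is applied to the removed sets, so that a
  maximal one leaves a minimal language. Chains are bounded by compactness: there are finitely many
  words of each length, so if a union removes them all, one member does. In a minimal language no
  \<open>u\<close> can be missing from arbitrarily long words, since the words avoiding
  \<open>u\<close> would form a smaller language.\<close>

lemma uniformly_recurrent_sublanguage: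
  assumes "finite C" and E: "language C E"
  shows "\<exists>D\<subseteq>E. language C D \<and> uniformly_recurrent D"
proof -
  let ?A = "{X. language C (E - X)}"
  have fin: "finite {u\<in>E. length u = n}" for n
    by (rule finite_subset[OF _ finite_lists_length_eq[OF assms(1), of n]])
      (use E in \<open>auto simp: language_def\<close>)
  have "\<exists>M\<in>?A. \<forall>X\<in>?A. M \<subseteq> X \<longrightarrow> X = M"
  proof (rule subset_Zorn)
    fix \<X> assume ch: "subset.chain ?A \<X>"
    show "\<exists>U\<in>?A. \<forall>X\<in>\<X>. X \<subseteq> U"
    proof (cases "\<X> = {}")
      case True
      then show ?thesis using E by (intro bexI[of _ "{}"]) auto
    next
      case False
      have lang: "language C (E - X)" if "X \<in> \<X>" for X
        using ch that by (auto simp: subset.chain_def)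
      have "\<exists>u\<in>E - \<Union>\<X>. length u = n" for n
      proof (rule ccontr)
        assume "\<not> ?thesis"
        then have "{u\<in>E. length u = n} \<subseteq> \<Union>\<X>" by blast
        from finite_subset_Union_chain[OF fin this False ch] obtain X
          where "X \<in> \<X>" "{u\<in>E. length u = n} \<subseteq> X" by blast
        then show False using lang[of X] unfolding language_def by blast
      qed
      moreover have "v \<in> E - \<Union>\<X>" if "u \<in> E - \<Union>\<X>" "sublist v u" for u v
        using that lang False unfolding language_def by blast
      ultimately have "language C (E - \<Union>\<X>)" using E unfolding language_def by blast
      then show ?thesis by blast
    qed
  qed
  then obtain M where M: "language C (E - M)" "\<And>X. language C (E - X) \<Longrightarrow> M \<subseteq> X \<Longrightarrow> X = M"
    by blast
  have "uniformly_recurrent (E - M)"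
  proof (rule ccontr)
    assume "\<not> ?thesis"
    then obtain u where u: "u \<in> E - M" "\<And>n. \<exists>w\<in>E - M. n \<le> length w \<and> \<not> sublist u w"
      unfolding uniformly_recurrent_def by blast
    let ?X = "M \<union> {w. sublist u w}"
    have "\<exists>w\<in>E - ?X. length w = n" for n
    proof -
      obtain w where w: "w \<in> E - M" "n \<le> length w" "\<not> sublist u w" using u(2) by blast
      have s: "sublist (take n w) w" by simp
      then have "take n w \<in> E - M" using w M(1) language_sublist by blast
      moreover have "\<not> sublist u (take n w)" using w(3) s sublist_order.order_trans by blast
      ultimately show ?thesis using w(2) by (intro bexI[of _ "take n w"]) auto
    qed
    moreover have "v \<in> E - ?X" if "w \<in> E - ?X" "sublist v w" for v w
      using that M(1) language_sublist[of C "E - M" w v] sublist_order.order_trans[of u v w] by auto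
    ultimately have "language C (E - ?X)" using E unfolding language_def by blast
    from M(2)[OF this] have "?X = M" by blast
    then show False using u(1) by auto
  qed
  then show ?thesis using M(1) by blast
qed

section \<open>Images under maps of constant length and their overlaps\<close>

lemma length_concat_map_uniform:
  assumes "\<And>c. c \<in> set u \<Longrightarrow> length (h c) = N"
  shows "length (concat (map h u)) = length u * N"
  using assms by (induction u) auto

lemma nth_concat_map_uniform:
  assumes "\<And>c. c \<in> set u \<Longrightarrow> length (h c) = N" "i < length u" "j < N"
  shows "concat (map h u) ! (i * N + j) = h (u ! i) ! j"
  using assms
proof (induction u arbitrary: i)
  case (Cons c u)
  show ?case
  proof (cases i)
    case 0
    then show ?thesis using Cons.prems by (simp add: nth_append)
  next
    case (Suc i')
    then show ?thesis using Cons.prems Cons.IH[of i'] by (simp add: nth_append)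
  qed
qed simp

lemma nth_concat_map_uniform_pair:
  assumes "\<And>c. c \<in> set u \<Longrightarrow> length (h c) = N" "Suc i < length u" "j < 2 * N"
  shows "concat (map h u) ! (i * N + j) = (h (u ! i) @ h (u ! Suc i)) ! j"
proof (cases "j < N")
  case True
  then show ?thesis using assms nth_concat_map_uniform[of u h N i j] by (simp add: nth_append)
next
  case False
  then have "i * N + j = Suc i * N + (j - N)" by simp
  then show ?thesis
    using False assms nth_concat_map_uniform[of u h N "Suc i" "j - N"] by (simp add: nth_append)
qed

text \<open>The combinatorial trace of an overlap at a fixed offset: the block of
  \<open>u ! i\<close> lies across the blocks of \<open>v ! i\<close> and \<open>v ! Suc i\<close>,
  which is why \<open>v\<close> is one letter longer. Neither the block map nor the block length is
  mentioned, so there are finitely many \<open>P\<close> for all scales together.\<close>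

definition compatible :: "'c list set \<Rightarrow> ('c \<times> 'c \<times> 'c) set \<Rightarrow> nat \<Rightarrow> bool" where
  "compatible D P n \<longleftrightarrow> (\<exists>u\<in>D. \<exists>v\<in>D. length u = n \<and> length v = Suc n \<and>
     (\<forall>i<n. (u ! i, v ! i, v ! Suc i) \<in> P))"

lemma compatible_mono:
  assumes "language C D" "compatible D P n" "m \<le> n"
  shows "compatible D P m"
proof -
  obtain u v where uv: "u \<in> D" "v \<in> D" "length u = n" "length v = Suc n"
    "\<forall>i<n. (u ! i, v ! i, v ! Suc i) \<in> P"
    using assms(2) unfolding compatible_def by blast
  have "take m u \<in> D" "take (Suc m) v \<in> D"
    using language_take_drop[OF assms(1) uv(1), of m 0] language_take_drop[OF assms(1) uv(2), of "Suc m" 0]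
    by simp_all
  then show ?thesis unfolding compatible_def
    using uv(3-5) assms(3) by (intro bexI[of _ "take m u"] bexI[of _ "take (Suc m) v"]) auto
qed

text \<open>Each \<open>P\<close> that fails somewhere fails from some length on; \<open>T\<close>
  is the maximum of such lengths over the finitely many \<open>P\<close>. This is the source of the
  constant independent of the scale.\<close>

lemma compatible_bound:
  assumes "finite C" and D: "language C D"
  shows "\<exists>T. \<forall>P \<subseteq> C \<times> C \<times> C. compatible D P T \<longrightarrow> (\<forall>n. compatible D P n)"
proof -
  have "\<forall>P \<in> Pow (C \<times> C \<times> C). \<exists>T. compatible D P T \<longrightarrow> (\<forall>n. compatible D P n)" by blast
  from bchoice[OF this] obtain T
    where T: "\<And>P. P \<subseteq> C \<times> C \<times> C \<Longrightarrow> compatible D P (T P) \<Longrightarrow> \<forall>n. compatible D P n"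
    by blast
  let ?T = "Max (T ` Pow (C \<times> C \<times> C))"
  have "T P \<le> ?T" if "P \<subseteq> C \<times> C \<times> C" for P
    using that assms(1) by (intro Max_ge) auto
  then show ?thesis using T compatible_mono[OF D] by blast
qed

text \<open>A nonempty subset of a finite group that is closed under addition is a subgroup: modulo
  \<open>N\<close>, adding \<open>N - 1\<close> copies of an element subtracts it. In this way
  \<open>r mod g\<close> is obtained from \<open>r\<close>, and minimality of \<open>g\<close> makes
  it 0.\<close>

lemma nat_set_multiples:
  fixes R :: "nat \<Rightarrow> bool"
  assumes "N > 0" "R N" and add: "\<And>a b. R a \<Longrightarrow> R b \<Longrightarrow> R (a + b)"
    and mod: "\<And>a b. a mod N = b mod N \<Longrightarrow> R a \<Longrightarrow> R b"
  shows "\<exists>g>0. R = (\<lambda>r. g dvd r)"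
proof -
  define g where "g = (LEAST g. g > 0 \<and> R g)"
  have g: "g > 0" "R g" using LeastI[of "\<lambda>g. g > 0 \<and> R g" N] assms(1,2) by (auto simp: g_def)
  have least: "g \<le> r" if "r > 0" "R r" for r unfolding g_def by (rule Least_le) (use that in simp)
  have R0: "R 0" using mod[of N 0] assms(2) by simp
  have mult: "R (n * r)" if "R r" for n r
    by (induction n) (use R0 add that in simp_all)
  have "g dvd r" if "R r" for r
  proof -
    have "R (r + (N - 1) * (r div g * g))" using mult add g that by blast
    moreover have "r + (N - 1) * (r div g * g) = r mod g + N * (r div g * g)"
      using assms(1) by (cases N) (simp_all add: algebra_simps)
    ultimately have "R (r mod g)"
      by (intro mod[of "r mod g + N * (r div g * g)" "r mod g"]) simp_all
    then have "r mod g = 0" using least[of "r mod g"] mod_less_divisor[OF g(1), of r] by linarith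
    then show ?thesis by (rule mod_0_imp_dvd)
  qed
  moreover have "R r" if "g dvd r" for r using that mult[OF g(2)] by (metis dvdE mult.commute)
  ultimately show ?thesis using g(1) by blast
qed

text \<open>For a fixed point of a substitution of constant length \<open>k\<close>, apply this to \<open>N = k ^ m\<close>;
  it is essential that the bound \<open>T\<close> does not depend on \<open>N\<close>.\<close>

theorem uniform_recognizability:
  assumes finC: "finite C" and D: "language C D" and rec: "uniformly_recurrent D"
  shows "\<exists>T. \<forall>(h :: 'c \<Rightarrow> 'b list) N Q. N > 0 \<longrightarrow> (\<forall>c\<in>C. length (h c) = N) \<longrightarrow>
     (\<forall>u\<in>D. \<forall>p P l. P > 0 \<longrightarrow> p + P + l \<le> length (concat (map h u)) \<longrightarrow>
        (\<forall>t<l. concat (map h u) ! (p + t) = concat (map h u) ! (p + P + t)) \<longrightarrow> l < Q * P) \<longrightarrow>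
     (\<exists>g>0. N \<le> Suc Q * card C * g \<and>
       (\<forall>u\<in>D. \<forall>p q l. p \<le> q \<longrightarrow> q + l \<le> length (concat (map h u)) \<longrightarrow> T * N \<le> l \<longrightarrow>
          (\<forall>t<l. concat (map h u) ! (p + t) = concat (map h u) ! (q + t)) \<longrightarrow> g dvd q - p))"
proof -
  obtain T where T: "\<And>P. P \<subseteq> C \<times> C \<times> C \<Longrightarrow> compatible D P T \<Longrightarrow> (\<forall>n. compatible D P n)"
    using compatible_bound[OF finC D] by blast
  show ?thesis
  \<comment> \<open>Moving \<open>p\<close> up to a block boundary costs less than one block. The
    second extra block is there because \<open>T\<close> blocks read from that boundary lie across
    \<open>T + 1\<close> blocks on the side of \<open>q\<close>.\<close>
  proof (rule exI[of _ "T + 2"], intro allI impI)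
    fix h :: "'c \<Rightarrow> 'b list" and N Q :: nat
    assume N: "N > 0" and lenh: "\<forall>c\<in>C. length (h c) = N"
    let ?H = "\<lambda>u. concat (map h u)"
    assume nopow: "\<forall>u\<in>D. \<forall>p P l. P > 0 \<longrightarrow> p + P + l \<le> length (?H u) \<longrightarrow>
        (\<forall>t<l. ?H u ! (p + t) = ?H u ! (p + P + t)) \<longrightarrow> l < Q * P"
    have lh: "length (h c) = N" if "u \<in> D" "c \<in> set u" for u c
      using lenh language_letters[OF D that(1)] that(2) by blast
    have lenH: "length (?H u) = length u * N" if "u \<in> D" for u
      by (rule length_concat_map_uniform) (use lh that in blast)
    have nthH: "?H u ! (i * N + j) = h (u ! i) ! j" if "u \<in> D" "i < length u" "j < N" for u i j
      by (rule nth_concat_map_uniform) (use lh that in auto)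
    have nthH2: "?H u ! (i * N + j) = (h (u ! i) @ h (u ! Suc i)) ! j"
      if "u \<in> D" "Suc i < length u" "j < 2 * N" for u i j
      by (rule nth_concat_map_uniform_pair) (use lh that in auto)
    \<comment> \<open>\<open>R r\<close> says that images of arbitrarily long words reappear inside
      images at offset \<open>r\<close>, so that this offset cannot be told from 0 by looking at
      images. Asking it of all words of \<open>D\<close> makes two such embeddings composable, hence
      \<open>R\<close> additive.\<close>
    define R where "R r \<longleftrightarrow> (\<forall>u\<in>D. \<exists>v\<in>D. \<exists>p. p mod N = r mod N \<and> p + length u * N \<le> length v * N \<and>
        (\<forall>j < length u * N. ?H u ! j = ?H v ! (p + j)))" for r
    have "\<exists>g>0. R = (\<lambda>r. g dvd r)"
    proof (rule nat_set_multiples[OF N])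
      show "R N" unfolding R_def
        by (intro ballI, rule bexI, rule exI[of _ 0]) auto
      show "R b" if "a mod N = b mod N" "R a" for a b using that unfolding R_def by metis
      show "R (a + b)" if ab: "R a" "R b" for a b unfolding R_def
      proof
        fix u assume "u \<in> D"
        then obtain v p where v: "v \<in> D" "p mod N = a mod N" "p + length u * N \<le> length v * N"
          "\<forall>j < length u * N. ?H u ! j = ?H v ! (p + j)" using ab(1) unfolding R_def by blast
        then obtain w q where w: "w \<in> D" "q mod N = b mod N" "q + length v * N \<le> length w * N"
          "\<forall>j < length v * N. ?H v ! j = ?H w ! (q + j)" using ab(2) unfolding R_def by blast
        have "?H u ! j = ?H w ! ((q + p) + j)" if "j < length u * N" for j
          using v(3,4) w(4) that by (simp add: add.assoc)
        moreover have "(q + p) mod N = (a + b) mod N"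
          using v(2) w(2) by (metis add.commute mod_add_cong)
        moreover have "(q + p) + length u * N \<le> length w * N" using v w by simp
        ultimately show "\<exists>v\<in>D. \<exists>p. p mod N = (a + b) mod N \<and> p + length u * N \<le> length v * N \<and>
          (\<forall>j < length u * N. ?H u ! j = ?H v ! (p + j))" using w(1) by blast
      qed
    qed
    then obtain g where g: "g > 0" "\<And>r. R r \<longleftrightarrow> g dvd r" by auto
    have gN: "g dvd N"
    proof -
      have "R N" unfolding R_def by (intro ballI, rule bexI, rule exI[of _ 0]) auto
      then show ?thesis using g by simp
    qed
    have bound: "N \<le> Suc Q * card C * g"
    proof (cases "N \<le> card C * g")
      case True
      also have "card C * g \<le> Suc Q * card C * g" by simp
      finally show ?thesis .
    next
      case False
      obtain u where u: "u \<in> D" "length u = 2" using D unfolding language_def by blast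
      \<comment> \<open>The offset \<open>N - j * g\<close> is a multiple of \<open>g\<close>, so
        the image of \<open>u\<close> embeds with that offset, and its window at
        \<open>j * g\<close> lands exactly on a block. Among \<open>card C + 1\<close> such windows
        two show the same block; they overlap in a repetition with period at most
        \<open>card C * g\<close>, which \<open>nopow\<close> compares with
        \<open>N\<close>.\<close>
      have "\<exists>c\<in>C. \<forall>t<N. ?H u ! (j * g + t) = h c ! t" if j: "j \<le> card C" for j
      proof -
        have jg: "j * g < N" using False j by (meson le_less_trans mult_le_mono1 not_le)
        have "g dvd N - j * g" using gN by (intro dvd_diff_nat) auto
        then obtain v p where v: "v \<in> D" "p mod N = (N - j * g) mod N" "p + 2 * N \<le> length v * N"
          "\<forall>i < 2 * N. ?H u ! i = ?H v ! (p + i)"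
          using g(2) u unfolding R_def by metis
        have "(p + j * g) mod N = ((N - j * g) + j * g) mod N" using v(2) by (metis mod_add_left_eq)
        then have "(p + j * g) mod N = 0" using jg by simp
        then obtain i where i: "p + j * g = i * N" by (metis mod_0_imp_dvd dvdE mult.commute)
        have "i * N < length v * N" using v(3) jg i by linarith
        then have il: "i < length v" by simp
        have "?H u ! (j * g + t) = h (v ! i) ! t" if t: "t < N" for t
        proof -
          have "?H u ! (j * g + t) = ?H v ! (p + (j * g + t))" using v(4) t jg by simp
          also have "p + (j * g + t) = i * N + t" using i by simp
          finally show ?thesis using nthH[OF v(1) il t] by simp
        qed
        moreover have "v ! i \<in> C" using il language_letters[OF D v(1)] by auto
        ultimately show ?thesis by blast
      qed
      then obtain c where c: "\<And>j. j \<le> card C \<Longrightarrow> c j \<in> C"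
        "\<And>j t. j \<le> card C \<Longrightarrow> t < N \<Longrightarrow> ?H u ! (j * g + t) = h (c j) ! t" by metis
      have "\<not> inj_on c {..card C}"
        using card_inj_on_le[of c "{..card C}" C] c(1) finC by fastforce
      then obtain i j where ij: "i < j" "j \<le> card C" "c i = c j"
        unfolding inj_on_def by (metis atMost_iff linorder_neqE_nat)
      have jg: "j * g < N" using False ij by (meson le_less_trans mult_le_mono1 not_le)
      have eq: "i * g + (j - i) * g = j * g" using ij by (simp add: add_mult_distrib[symmetric])
      have "N < Q * ((j - i) * g)"
      proof (rule nopow[rule_format, OF u(1)])
        show "0 < (j - i) * g" using ij g by simp
        show "i * g + (j - i) * g + N \<le> length (?H u)" unfolding eq lenH[OF u(1)] u(2) using jg by simp
        show "?H u ! (i * g + t) = ?H u ! (i * g + (j - i) * g + t)" if "t < N" for t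
          unfolding eq using c(2)[of i t] c(2)[of j t] ij that by simp
      qed
      also have "\<dots> \<le> Q * (card C * g)" using ij by (intro mult_le_mono) auto
      finally show ?thesis by (simp add: algebra_simps)
    qed
    have recog: "g dvd q - p" if u: "u \<in> D" and pq: "p \<le> q" "q + l \<le> length (?H u)" "(T + 2) * N \<le> l"
      and eq: "\<forall>t<l. ?H u ! (p + t) = ?H u ! (q + t)" for u p q l
    proof -
      \<comment> \<open>The first block boundary at or after \<open>p\<close> is
        \<open>i * N\<close>, at distance \<open>e\<close>; the matching position
        \<open>q + e\<close> lies in block \<open>j\<close> at offset \<open>r\<close>.\<close>
      define i where "i = (p + (N - 1)) div N"
      define e where "e = i * N - p"
      have "(p + (N - 1)) div N * N + (p + (N - 1)) mod N = p + (N - 1)" by simp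
      then have ie: "i * N = p + e" "e < N"
        using N mod_less_divisor[of N "p + (N - 1)"] unfolding e_def i_def by linarith+
      define j r where "j = (q + e) div N" and "r = (q + e) mod N"
      have jr: "q + e = j * N + r" "r < N" using N by (auto simp: j_def r_def)
      have T2: "(T + 2) * N = T * N + 2 * N" by (simp add: algebra_simps)
      have lu: "q + (T * N + 2 * N) \<le> length u * N" using pq lenH[OF u] T2 by linarith
      have "(i + T) * N \<le> length u * N" using ie lu pq by (simp add: add_mult_distrib)
      then have li: "i + T \<le> length u" using N by simp
      have "(j + T + 1) * N \<le> length u * N" using jr ie lu by (simp add: add_mult_distrib)
      then have lj: "j + T + 1 \<le> length u" using N by (metis mult_le_cancel2)
      define P where "P = {(a, b, c) \<in> C \<times> C \<times> C. \<forall>t<N. h a ! t = (h b @ h c) ! (r + t)}"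
      have "compatible D P T" unfolding compatible_def
      proof (rule bexI[of _ "take T (drop i u)"], rule bexI[of _ "take (Suc T) (drop j u)"],
          intro conjI allI impI)
        show "take T (drop i u) \<in> D" "take (Suc T) (drop j u) \<in> D"
          using language_take_drop[OF D u] by auto
        show "length (take T (drop i u)) = T" "length (take (Suc T) (drop j u)) = Suc T"
          using li lj by auto
        fix d assume d: "d < T"
        have "h (u ! (i + d)) ! t = (h (u ! (j + d)) @ h (u ! Suc (j + d))) ! (r + t)" if t: "t < N" for t
        proof -
          have dN: "d * N + N \<le> T * N" using d by (metis Suc_leI add.commute mult_Suc mult_le_mono1)
          have "h (u ! (i + d)) ! t = ?H u ! ((i + d) * N + t)"
            using nthH[OF u, of "i + d" t] li d t by simp
          also have "(i + d) * N + t = p + (e + d * N + t)" using ie by (simp add: algebra_simps)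
          also have "?H u ! (p + (e + d * N + t)) = ?H u ! (q + (e + d * N + t))"
            using eq ie t dN pq T2 by simp
          also have "q + (e + d * N + t) = (j + d) * N + (r + t)" using jr by (simp add: algebra_simps)
          also have "?H u ! ((j + d) * N + (r + t)) = (h (u ! (j + d)) @ h (u ! Suc (j + d))) ! (r + t)"
            by (rule nthH2[OF u]) (use lj d jr t in auto)
          finally show ?thesis .
        qed
        moreover have "u ! (i + d) \<in> C" "u ! (j + d) \<in> C" "u ! Suc (j + d) \<in> C"
          using language_letters[OF D u] li lj d by (auto intro!: subsetD[OF _ nth_mem])
        ultimately show "(take T (drop i u) ! d, take (Suc T) (drop j u) ! d, take (Suc T) (drop j u) ! Suc d) \<in> P"
          unfolding P_def using d li lj by simp
      qed
      then have all: "compatible D P n" for n using T[of P] unfolding P_def by blast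
      \<comment> \<open>Uniform recurrence enters here: the first word of a long compatible pair
        contains the given \<open>w\<close>, and the part of the second word facing it contains the
        image of \<open>w\<close> at offset \<open>r\<close>.\<close>
      have "R r" unfolding R_def
      proof
        fix w assume w: "w \<in> D"
        obtain n where n: "\<And>w'. w' \<in> D \<Longrightarrow> n \<le> length w' \<Longrightarrow> sublist w w'"
          using rec w unfolding uniformly_recurrent_def by blast
        obtain w' v where v: "w' \<in> D" "v \<in> D" "length w' = n" "length v = Suc n"
          "\<forall>i<n. (w' ! i, v ! i, v ! Suc i) \<in> P" using all[of n] unfolding compatible_def by blast
        obtain ps ss where ps: "w' = ps @ w @ ss" using n[of w'] v unfolding sublist_def by auto
        let ?v = "take (Suc (length w)) (drop (length ps) v)"
        have vD: "?v \<in> D" using language_take_drop[OF D v(2)] .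
        have lv: "length ?v = Suc (length w)" using ps v(3,4) by simp
        have "?H w ! x = ?H ?v ! (r + x)" if x: "x < length w * N" for x
        proof -
          define d t where "d = x div N" and "t = x mod N"
          have dt: "x = d * N + t" "t < N" using N by (auto simp: d_def t_def)
          have d: "d < length w" using x N by (simp add: d_def less_mult_imp_div_less)
          have "(w' ! (length ps + d), v ! (length ps + d), v ! Suc (length ps + d)) \<in> P"
            using v(5)[rule_format, of "length ps + d"] ps v(3) d by simp
          then have "h (w ! d) ! t = (h (?v ! d) @ h (?v ! Suc d)) ! (r + t)"
            using dt ps v(3,4) d by (simp add: P_def nth_append)
          also have "\<dots> = ?H ?v ! (d * N + (r + t))"
            by (rule nthH2[OF vD, symmetric]) (use lv d dt jr in auto)
          also have "d * N + (r + t) = r + x" using dt by simp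
          finally show ?thesis using nthH[OF w d dt(2)] dt(1) by simp
        qed
        then show "\<exists>v\<in>D. \<exists>p. p mod N = r mod N \<and> p + length w * N \<le> length v * N \<and>
          (\<forall>x < length w * N. ?H w ! x = ?H v ! (p + x))"
          using vD lv jr by (intro bexI[of _ ?v] exI[of _ r]) auto
      qed
      moreover have "(q - p) mod N = r mod N"
      proof -
        have "q - p + i * N = r + j * N" using ie jr pq by linarith
        then show ?thesis by (metis mod_mult_self1)
      qed
      ultimately have "R (q - p)" unfolding R_def by metis
      then show ?thesis using g by simp
    qed
    show "\<exists>g>0. N \<le> Suc Q * card C * g \<and>
       (\<forall>u\<in>D. \<forall>p q l. p \<le> q \<longrightarrow> q + l \<le> length (?H u) \<longrightarrow> (T + 2) * N \<le> l \<longrightarrow>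
          (\<forall>t<l. ?H u ! (p + t) = ?H u ! (q + t)) \<longrightarrow> g dvd q - p)"
      using g(1) bound recog by blast
  qed
qed

subsection \<open>Growth of primitive substitutions\<close>

lemma subst_word_pow_add: "(subst_word \<phi> ^^ (m + n)) w = (subst_word \<phi> ^^ m) ((subst_word \<phi> ^^ n) w)"
  by (simp add: funpow_add)

locale primitive_substitution =
  fixes A :: "'a set" and \<phi> :: "'a \<Rightarrow> 'a list"
  assumes finite_A: "finite A" and A_nonempty: "A \<noteq> {}"
    and subst_closed: "a \<in> A \<Longrightarrow> set (\<phi> a) \<subseteq> A"
    and nonerasing: "a \<in> A \<Longrightarrow> \<phi> a \<noteq> []"
    and all_letters: "\<exists>n\<ge>1. \<forall>a\<in>A. A \<subseteq> set ((subst_word \<phi> ^^ n) [a])"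
begin

abbreviation "iter \<equiv> \<lambda>n. subst_word \<phi> ^^ n"
abbreviation "L \<equiv> iter_length \<phi>"

lemma set_subst_word: "set w \<subseteq> A \<Longrightarrow> set (subst_word \<phi> w) \<subseteq> A"
  using subst_closed by (fastforce simp: subst_word_def)

lemma set_iter: "set w \<subseteq> A \<Longrightarrow> set (iter n w) \<subseteq> A"
  by (induction n) (use set_subst_word in auto)

lemma length_subst_word_ge: "set w \<subseteq> A \<Longrightarrow> length w \<le> length (subst_word \<phi> w)"
proof (induction w)
  case (Cons a w)
  then have "length (\<phi> a) \<ge> 1" "length w \<le> length (subst_word \<phi> w)"
    using nonerasing[of a] by (auto simp: Suc_le_eq)
  then show ?case by (simp add: subst_word_def)
qed simp

lemma length_iter_mono: "set w \<subseteq> A \<Longrightarrow> m \<le> n \<Longrightarrow> length (iter m w) \<le> length (iter n w)"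
  by (rule lift_Suc_mono_le[of "\<lambda>n. length (iter n w)"])
    (simp_all add: length_subst_word_ge set_iter)

lemma L_pos: "a \<in> A \<Longrightarrow> 0 < L n a"
  using length_iter_mono[of "[a]" 0 n] by (simp del: length_greater_0_conv)

lemma ex_all_letters: "\<exists>k\<ge>1. \<forall>n\<ge>k. \<forall>a\<in>A. A \<subseteq> set (iter n [a])"
proof -
  obtain k where k: "k \<ge> 1" "\<And>a. a \<in> A \<Longrightarrow> A \<subseteq> set (iter k [a])" using all_letters by blast
  have "A \<subseteq> set (iter n [a])" if "n \<ge> k" "a \<in> A" for n a
  proof -
    have n: "iter n [a] = iter k (iter (n - k) [a])"
      using that(1) subst_word_pow_add[of k "n - k" \<phi> "[a]"] by simp
    have "iter (n - k) [a] \<noteq> []" using L_pos[OF that(2), of "n - k"] by auto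
    then obtain b w where bw: "iter (n - k) [a] = [b] @ w" by (metis append_Cons append_Nil list.exhaust)
    then have "b \<in> A" using set_iter[of "[a]" "n - k"] that(2) by auto
    then show ?thesis unfolding n bw subst_word_pow_append using k(2) by auto
  qed
  then show ?thesis using k(1) by blast
qed

text \<open>The letter \<open>a\<close> occurs in \<open>iter k [b]\<close>, so its iterates are no
  longer than those of \<open>b\<close> taken \<open>k\<close> steps further, and each step
  multiplies lengths by at most \<open>B\<close>. Hence the lengths of all letters are comparable
  uniformly in \<open>n\<close>.\<close>

lemma L_Suc_le: "\<exists>K. \<forall>n. \<forall>a\<in>A. \<forall>b\<in>A. L (Suc n) a \<le> K * L n b"
proof -
  obtain k where k: "\<And>a. a \<in> A \<Longrightarrow> A \<subseteq> set (iter k [a])" using all_letters by blast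
  define B where "B = Max ((\<lambda>a. length (\<phi> a)) ` A)"
  have B: "length (\<phi> a) \<le> B" if "a \<in> A" for a
    unfolding B_def using finite_A that by (intro Max_ge) auto
  have "length (subst_word \<phi> w) \<le> B * length w" if "set w \<subseteq> A" for w
    using that
  proof (induction w)
    case (Cons a w)
    then show ?case using B[of a] by (simp add: subst_word_def)
  qed simp
  then have step: "length (iter (Suc n) w) \<le> B * length (iter n w)" if "set w \<subseteq> A" for n w
    using set_iter[OF that] by simp
  have steps: "L (n + m) a \<le> B ^ m * L n a" if "a \<in> A" for n m a
  proof (induction m)
    case (Suc m)
    have "L (n + Suc m) a \<le> B * L (n + m) a" using step[of "[a]"] that by simp
    also have "\<dots> \<le> B ^ Suc m * L n a" using Suc by (simp add: mult.assoc)
    finally show ?case .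
  qed simp
  have "L (Suc n) a \<le> B * B ^ k * L n b" if ab: "a \<in> A" "b \<in> A" for n a b
  proof -
    obtain u v where "iter k [b] = u @ [a] @ v"
      using k[OF ab(2)] ab(1) split_list[of a] by fastforce
    then have "L n a \<le> L (n + k) b" 
      using subst_word_pow_append[of n \<phi> "[a]" v] by (simp add: subst_word_pow_add)
    also have "\<dots> \<le> B ^ k * L n b" using steps ab by simp
    finally have "L n a \<le> B ^ k * L n b" .
    then have "B * L n a \<le> B * (B ^ k * L n b)" by (rule mult_le_mono2)
    moreover have "L (Suc n) a \<le> B * L n a" using step[of "[a]"] ab by simp
    ultimately show ?thesis by (simp only: mult.assoc)
  qed
  then show ?thesis by blast
qed

text \<open>With two distinct letters, \<open>iter k\<close> of any letter contains both, so
  \<open>k\<close> steps at least double every length. A single letter could be mapped to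
  itself.\<close>

lemma L_unbounded:
  assumes "a \<in> A" "b \<in> A" "a \<noteq> b"
  shows "\<exists>n. \<forall>m\<ge>n. \<forall>c\<in>A. K \<le> L m c"
proof -
  obtain k where k: "\<And>a. a \<in> A \<Longrightarrow> A \<subseteq> set (iter k [a])" using all_letters by blast
  have two: "2 \<le> L k c" if "c \<in> A" for c
  proof -
    have "card {a, b} \<le> card (set (iter k [c]))" using k[OF that] assms by (intro card_mono) auto
    also have "\<dots> \<le> L k c" by (rule card_length)
    finally show ?thesis using assms(3) by simp
  qed
  have double: "2 * length w \<le> length (iter k w)" if "set w \<subseteq> A" for w
    using that
  proof (induction w)
    case (Cons c w)
    then show ?case using two[of c] subst_word_pow_append[of k \<phi> "[c]" w] by simp
  qed simp
  have pow: "2 ^ j \<le> L (k * j) c" if "c \<in> A" for c j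
  proof (induction j)
    case (Suc j)
    have "L (k * Suc j) c = length (iter k (iter (k * j) [c]))" by (simp add: subst_word_pow_add)
    then show ?case using double[OF set_iter[of "[c]" "k * j"]] Suc that by simp
  qed simp
  have "K \<le> L m c" if "m \<ge> k * K" "c \<in> A" for m c
  proof -
    have "K \<le> 2 ^ K" by (rule less_imp_le[OF less_exp])
    also have "\<dots> \<le> L m c"
      using pow[OF that(2), of K] length_iter_mono[of "[c]" "k * K" m] that by simp
    finally show ?thesis .
  qed
  then show ?thesis by blast
qed

text \<open>A positive left eigenvector of a power of a primitive matrix is an eigenvector of the
  matrix itself: otherwise subtracting the largest possible multiple from its image would yield
  a nonnegative, nonzero eigenvector with a vanishing entry.\<close>

lemma proportional_Suc:
  assumes "N \<ge> 1"
    and prp: "\<And>a b. a \<in> A \<Longrightarrow> b \<in> A \<Longrightarrow> L (n + N) a * L n b = L (n + N) b * L n a"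
    and ab: "a \<in> A" "b \<in> A"
  shows "L (Suc n) a * L n b = L (Suc n) b * L n a"
proof -
  obtain k where k: "k \<ge> 1" "\<And>n a. n \<ge> k \<Longrightarrow> a \<in> A \<Longrightarrow> A \<subseteq> set (iter n [a])"
    using ex_all_letters by blast
  define len where "len n w = real (length (iter n w))" for n w
  have len_append: "len n (u @ v) = len n u + len n v" for n u v by (simp add: len_def)
  have len_Cons: "len n (a # v) = len n [a] + len n v" for n a v using len_append[of n "[a]" v] by simp
  have len_Nil: "len n [] = 0" for n by (simp add: len_def)
  define \<mu> where "\<mu> = len (n + N) [a] / len n [a]"
  have pos: "len n [c] > 0" if "c \<in> A" for c n using L_pos[OF that] by (simp add: len_def)
  have "len (n + N) [c] = \<mu> * len n [c]" if "c \<in> A" for c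
  proof -
    have "len (n + N) [c] * len n [a] = len (n + N) [a] * len n [c]"
      using prp[OF that ab(1)] unfolding len_def by (metis of_nat_mult)
    then show ?thesis using pos[OF ab(1), of n] by (simp add: \<mu>_def field_simps)
  qed
  then have mu: "len (n + N) w = \<mu> * len n w" if "set w \<subseteq> A" for w
    using that
  proof (induction w)
    case (Cons c w)
    then show ?case unfolding len_Cons[of _ c w] by (simp add: algebra_simps)
  qed (simp add: len_Nil)
  define t where "t = Min ((\<lambda>c. len (Suc n) [c] / len n [c]) ` A)"
  have "t \<in> (\<lambda>c. len (Suc n) [c] / len n [c]) ` A"
    unfolding t_def using finite_A A_nonempty by (intro Min_in) auto
  then obtain c where c: "c \<in> A" "t = len (Suc n) [c] / len n [c]" by blast
  have t: "t \<le> len (Suc n) [e] / len n [e]" if "e \<in> A" for e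
    unfolding t_def using finite_A that by (intro Min_le) auto
  \<comment> \<open>The linear functional on words whose values on letters form the difference of
    the length vector at \<open>Suc n\<close> and \<open>t\<close> times the one at
    \<open>n\<close>. By choice of \<open>t\<close> it is nonnegative and vanishes at
    \<open>c\<close>; applying \<open>iter N\<close> multiplies it by \<mu>.\<close>
  define d where "d w = len (Suc n) w - t * len n w" for w
  have d_append: "d (u @ v) = d u + d v" for u v by (simp add: d_def len_append algebra_simps)
  have d_nonneg_letter: "d [e] \<ge> 0" if "e \<in> A" for e
    using t[OF that] pos[OF that, of n] by (simp add: d_def field_simps)
  have d_Cons: "d (e # w) = d [e] + d w" for e w using d_append[of "[e]" w] by simp
  have d_nonneg: "d w \<ge> 0" if "set w \<subseteq> A" for w
    using that
  proof (induction w)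
    case Nil then show ?case by (simp add: d_def len_Nil)
  next
    case (Cons e w)
    then show ?case using d_nonneg_letter[of e] unfolding d_Cons[of e w] by simp
  qed
  have d_iter: "d (iter N w) = \<mu> * d w" if w: "set w \<subseteq> A" for w
  proof -
    have "len n (iter N w) = \<mu> * len n w"
      using mu[OF w] by (simp add: len_def subst_word_pow_add)
    moreover have "len (Suc n) (iter N w) = len (n + N) (subst_word \<phi> w)"
      unfolding len_def using subst_word_pow_add[of "Suc n" N \<phi> w] subst_word_pow_add[of "n + N" 1 \<phi> w]
      by simp
    moreover have "\<dots> = \<mu> * len n (subst_word \<phi> w)" using mu[OF set_subst_word[OF w]] .
    moreover have "len n (subst_word \<phi> w) = len (Suc n) w"
      unfolding len_def using subst_word_pow_add[of n 1 \<phi> w] by simp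
    ultimately show ?thesis by (simp add: d_def algebra_simps)
  qed
  have d_pow: "d (iter (N * j) [c]) = 0" for j
  proof (induction j)
    case 0 then show ?case using c pos[OF c(1), of n] by (simp add: d_def)
  next
    case (Suc j)
    then show ?case using d_iter[OF set_iter[of "[c]" "N * j"]] c(1)
      by (simp add: subst_word_pow_add)
  qed
  have "d [e] = 0" if e: "e \<in> A" for e
  proof -
    \<comment> \<open>The exponent has to be a multiple of \<open>N\<close>, so that
      \<open>d\<close> vanishes on the iterate of \<open>c\<close>, and at least \<open>k\<close>,
      so that every letter occurs in it. A vanishing sum of nonnegative terms then has only zero
      terms.\<close>
    have "k \<le> N * k" using assms(1) by simp
    then obtain u v where uv: "iter (N * k) [c] = u @ [e] @ v"
      using k(2)[OF _ c(1), of "N * k"] e split_list[of e] by fastforce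
    have "set (u @ [e] @ v) \<subseteq> A" using set_iter[of "[c]" "N * k"] c(1) unfolding uv[symmetric] by simp
    then have "d u \<ge> 0" "d v \<ge> 0" using d_nonneg by simp_all
    moreover have "d u + (d [e] + d v) = 0" using d_pow[of k] unfolding uv d_append .
    ultimately show ?thesis using d_nonneg_letter[OF e] by linarith
  qed
  then have "len (Suc n) [e] = t * len n [e]" if "e \<in> A" for e using that by (simp add: d_def)
  then have "len (Suc n) [a] * len n [b] = len (Suc n) [b] * len n [a]" using ab by simp
  then show ?thesis unfolding len_def by (simp only: of_nat_mult[symmetric] of_nat_eq_iff)
qed

end

subsection \<open>Factors and blocks of sequences\<close>

text \<open>Common ground of \<open>nat\<close> and \<open>int\<close>: comparable indices differ by
  a natural number. One proof then covers one-sided and two-sided sequences.\<close>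

class discrete_index = linordered_semidom +
  assumes le_imp_of_nat_add: "a \<le> b \<Longrightarrow> \<exists>d. b = a + of_nat d"

instance nat :: discrete_index
  by standard (metis le_iff_add of_nat_id)

instance int :: discrete_index
  by standard (metis zle_iff_zadd)

lemma discrete_index_induct [consumes 0, case_names zero up down]:
  fixes P :: "'i :: discrete_index \<Rightarrow> bool"
  assumes "P 0" and up: "\<And>i. P i \<Longrightarrow> P (i + 1)" and down: "\<And>i. P (i + 1) \<Longrightarrow> P i"
  shows "P i"
proof (cases "0 \<le> i")
  case True
  then obtain d where i: "i = of_nat d" using le_imp_of_nat_add[of 0 i] by auto
  have "P (of_nat d)" by (induction d) (use assms up[of "of_nat _"] in \<open>simp_all add: add.commute\<close>)
  then show ?thesis using i by simp
next
  case False
  then obtain d where d: "0 = i + of_nat d" using le_imp_of_nat_add[of i 0] by (metis linear)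
  have "P (i + of_nat d) \<Longrightarrow> P i"
  proof (induction d)
    case (Suc d)
    have "i + of_nat (Suc d) = i + of_nat d + 1" by (simp add: add_ac)
    then show ?case using Suc down by metis
  qed simp
  then show ?thesis using d assms(1) by metis
qed

definition factor :: "('i :: semiring_1 \<Rightarrow> 'a) \<Rightarrow> 'i \<Rightarrow> nat \<Rightarrow> 'a list" where
  "factor x i n = map (\<lambda>j. x (i + of_nat j)) [0..<n]"

lemma length_factor [simp]: "length (factor x i n) = n"
  by (simp add: factor_def)

lemma nth_factor [simp]: "j < n \<Longrightarrow> factor x i n ! j = x (i + of_nat j)"
  by (simp add: factor_def)

lemma factor_add: "factor x i (m + n) = factor x i m @ factor x (i + of_nat m) n"
  by (rule nth_equalityI) (auto simp: nth_append add.assoc simp flip: of_nat_add)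

lemma factor_Suc: "factor x i (Suc n) = factor x i n @ [x (i + of_nat n)]"
  by (simp add: factor_def)

lemma factor_1: "factor x i (Suc 0) = [x i]"
  by (simp add: factor_def)

lemma factor_0 [simp]: "factor x i 0 = []"
  by (simp add: factor_def)

lemma map_factor: "map f (factor x i n) = factor (f \<circ> x) i n"
  by (simp add: factor_def)

lemma set_factor: "set (factor x i n) \<subseteq> range x"
  by (auto simp: factor_def)

lemma sublist_factor: "m + k \<le> n \<Longrightarrow> sublist (factor x (i + of_nat m) k) (factor x i n)"
proof -
  assume "m + k \<le> n"
  then have "factor x i n = factor x i m @ factor x (i + of_nat m) k @ factor x (i + of_nat m + of_nat k) (n - (m + k))"
    using factor_add[of x i m "k + (n - (m + k))"]
      factor_add[of x "i + of_nat m" k "n - (m + k)"] by simp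
  then show ?thesis unfolding sublist_def by blast
qed

lemma sublist_factorE:
  assumes "sublist u (factor x i n)"
  obtains m where "m + length u \<le> n" "u = factor x (i + of_nat m) (length u)"
proof -
  obtain ps ss where e: "factor x i n = ps @ u @ ss" using assms unfolding sublist_def by blast
  then have n: "n = length ps + (length u + length ss)" by (metis length_factor length_append)
  have "factor x i (length ps) @ factor x (i + of_nat (length ps)) (length u) @
      factor x (i + of_nat (length ps) + of_nat (length u)) (length ss) = ps @ u @ ss"
    using e unfolding n factor_add .
  then have "u = factor x (i + of_nat (length ps)) (length u)"
    by (simp add: append_eq_append_conv)
  then show thesis using that n by (metis add.assoc le_add1)
qed

text \<open>This is \<open>subst_seq h x z\<close> with the positions of the blocks exposed.\<close>

definition block_start :: "('a \<Rightarrow> 'b list) \<Rightarrow> ('i :: semiring_1 \<Rightarrow> 'a) \<Rightarrow> ('i \<Rightarrow> 'b) \<Rightarrow> ('i \<Rightarrow> 'i) \<Rightarrow> bool" where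
  "block_start h x z pos \<longleftrightarrow> pos 0 = 0 \<and>
     (\<forall>i. pos (i + 1) = pos i + of_nat (length (h (x i)))) \<and>
     (\<forall>i. factor z (pos i) (length (h (x i))) = h (x i)) \<and>
     (\<forall>n. \<exists>i. \<exists>j < length (h (x i)). n = pos i + of_nat j)"

lemma pos_add:
  assumes "\<forall>i. pos (i + 1) = pos i + of_nat (length (h (x i)))"
  shows "pos (i + of_nat d) = pos i + of_nat (length (concat (map h (factor x i d))))"
proof (induction d)
  case (Suc d)
  have "pos (i + of_nat (Suc d)) = pos (i + of_nat d + 1)" by (simp add: add_ac)
  also have "\<dots> = pos (i + of_nat d) + of_nat (length (h (x (i + of_nat d))))" using assms by blast
  also have "\<dots> = pos i + of_nat (length (concat (map h (factor x i (Suc d)))))"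
    unfolding Suc factor_Suc by (simp add: add.assoc)
  finally show ?case .
qed simp

text \<open>The start of a later block lies at or beyond the end of an earlier one. Uniqueness is
  needed because \<open>subst_seq\<close> only asserts that each position has some block with the
  right letter; it upgrades this to every position of every block.\<close>

lemma block_unique:
  fixes pos :: "'i :: discrete_index \<Rightarrow> 'i"
  assumes pos: "\<forall>i. pos (i + 1) = pos i + of_nat (length (h (x i)))"
    and "j < length (h (x i))" "j' < length (h (x i'))" "pos i + of_nat j = pos i' + of_nat j'"
  shows "i = i' \<and> j = j'"
proof -
  have less: False
    if lt: "i < i'" "j < length (h (x i))" "pos i + of_nat j = pos i' + of_nat j'" for i i' j j'
  proof -
    obtain d where d: "i' = i + of_nat d" using le_imp_of_nat_add[of i i'] less_imp_le[OF lt(1)] by metis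
    then obtain d' where d': "d = Suc d'" using lt(1) by (cases d) auto
    have "pos i' = pos (i + 1 + of_nat d')" unfolding d d' by (simp add: add.assoc)
    also have "\<dots> = pos i + of_nat (length (h (x i))) + of_nat (length (concat (map h (factor x (i + 1) d'))))"
      unfolding pos_add[where h = h and x = x, OF pos, of "i + 1" d'] using pos by simp
    finally have "pos i' = pos i + of_nat (length (h (x i))) + of_nat (length (concat (map h (factor x (i + 1) d'))))" .
    then have "pos i + of_nat j = pos i + of_nat (length (h (x i)) + length (concat (map h (factor x (i + 1) d'))) + j')"
      using lt(3) by (simp add: add_ac)
    then have "j = length (h (x i)) + length (concat (map h (factor x (i + 1) d'))) + j'"
      by (simp only: add_left_cancel of_nat_eq_iff)
    then show False using lt(2) by simp
  qed
  have "i = i'" using less[of i i' j j'] less[of i' i j' j] assms(2-4) by (metis linorder_neqE)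
  then show ?thesis using assms(4) by simp
qed

lemma subst_seq_imp_block_start:
  fixes x z :: "'i :: discrete_index \<Rightarrow> 'a"
  assumes "subst_seq h x z"
  obtains pos where "block_start h x z pos"
proof -
  obtain pos where pos: "pos 0 = 0" "\<forall>i. pos (i + 1) = pos i + of_nat (length (h (x i)))"
    "\<forall>n. \<exists>i. \<exists>j < length (h (x i)). n = pos i + of_nat j \<and> z n = h (x i) ! j"
    using assms unfolding subst_seq_def by blast
  have "z (pos i + of_nat j) = h (x i) ! j" if "j < length (h (x i))" for i j
    using pos(3) block_unique[where h = h and x = x, OF pos(2) that] by metis
  then have "factor z (pos i) (length (h (x i))) = h (x i)" for i
    by (intro nth_equalityI) auto
  moreover have "\<forall>n. \<exists>i. \<exists>j < length (h (x i)). n = pos i + of_nat j" using pos(3) by blast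
  ultimately show thesis using that pos(1,2) unfolding block_start_def by blast
qed

lemma block_start_factor:
  fixes x :: "'i :: discrete_index \<Rightarrow> 'a"
  assumes "block_start h x z pos"
  shows "factor z (pos i) (length (concat (map h (factor x i d)))) = concat (map h (factor x i d))"
proof (induction d)
  case (Suc d)
  have pos: "\<forall>i. pos (i + 1) = pos i + of_nat (length (h (x i)))"
    using assms unfolding block_start_def by blast
  have "factor z (pos (i + of_nat d)) (length (h (x (i + of_nat d)))) = h (x (i + of_nat d))"
    using assms unfolding block_start_def by blast
  then show ?case using Suc by (simp add: factor_Suc factor_add pos_add[where h = h and x = x, OF pos])
qed simp

text \<open>Each block of the composite map is a run of consecutive blocks of \<open>g\<close>, so
  starting positions compose.\<close>

lemma block_start_comp:
  fixes x :: "'i :: discrete_index \<Rightarrow> 'a"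
  assumes h: "block_start h x y pos" and g: "block_start g y z pos'"
  shows "block_start (\<lambda>a. concat (map g (h a))) x z (pos' \<circ> pos)"
  unfolding block_start_def
proof (intro conjI allI)
  have h': "pos 0 = 0" "\<forall>i. pos (i + 1) = pos i + of_nat (length (h (x i)))"
    "\<And>i. factor y (pos i) (length (h (x i))) = h (x i)"
    "\<And>n. \<exists>i. \<exists>j < length (h (x i)). n = pos i + of_nat j"
    using h unfolding block_start_def by blast+
  have g': "pos' 0 = 0" "\<forall>i. pos' (i + 1) = pos' i + of_nat (length (g (y i)))"
    "\<And>n. \<exists>i. \<exists>j < length (g (y i)). n = pos' i + of_nat j"
    using g unfolding block_start_def by blast+
  show "(pos' \<circ> pos) 0 = 0" using h' g' by simp
  fix i
  show "(pos' \<circ> pos) (i + 1) = (pos' \<circ> pos) i + of_nat (length (concat (map g (h (x i)))))"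
    using h'(2) pos_add[where h = g and x = y, OF g'(2), of "pos i" "length (h (x i))"] h'(3)[of i] by simp
  show "factor z ((pos' \<circ> pos) i) (length (concat (map g (h (x i))))) = concat (map g (h (x i)))"
    using block_start_factor[OF g, of "pos i" "length (h (x i))"] h'(3)[of i] by simp
next
  fix n
  have h': "\<And>i. factor y (pos i) (length (h (x i))) = h (x i)"
    "\<And>n. \<exists>i. \<exists>j < length (h (x i)). n = pos i + of_nat j"
    using h unfolding block_start_def by blast+
  have g': "\<forall>i. pos' (i + 1) = pos' i + of_nat (length (g (y i)))"
    "\<And>n. \<exists>i. \<exists>j < length (g (y i)). n = pos' i + of_nat j"
    using g unfolding block_start_def by blast+
  obtain l j where l: "n = pos' l + of_nat j" "j < length (g (y l))" using g'(2) by blast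
  obtain i j' where i: "l = pos i + of_nat j'" "j' < length (h (x i))" using h'(2) by blast
  let ?u = "factor y (pos i) j'"
  obtain k where k: "length (h (x i)) = j' + (1 + k)" using i(2) by (auto simp: less_iff_Suc_add)
  have "h (x i) = factor y (pos i) (j' + (1 + k))" using h'(1)[of i] unfolding k by (rule sym)
  then have "length (concat (map g (h (x i)))) \<ge> length (concat (map g ?u)) + length (g (y l))"
    unfolding factor_add using i(1) by (simp add: factor_1)
  then have "length (concat (map g ?u)) + j < length (concat (map g (h (x i))))" using l(2) by simp
  moreover have "n = (pos' \<circ> pos) i + of_nat (length (concat (map g ?u)) + j)"
    using l(1) i(1) pos_add[where h = g and x = y, OF g'(1), of "pos i" j'] by (simp add: add_ac)
  ultimately show "\<exists>i. \<exists>j < length (concat (map g (h (x i)))). n = (pos' \<circ> pos) i + of_nat j" by blast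
qed

lemma block_start_iterate:
  fixes x :: "'i :: discrete_index \<Rightarrow> 'a"
  assumes "block_start \<phi> x x pos"
  shows "block_start (\<lambda>a. (subst_word \<phi> ^^ n) [a]) x x (pos ^^ n)"
proof (induction n)
  case 0
  show ?case unfolding block_start_def by (auto simp: factor_1)
next
  case (Suc n)
  have "(\<lambda>a. (subst_word \<phi> ^^ Suc n) [a]) = (\<lambda>a. concat (map \<phi> ((subst_word \<phi> ^^ n) [a])))"
    by (simp add: subst_word_def)
  moreover have "pos ^^ Suc n = pos \<circ> pos ^^ n" by simp
  ultimately show ?case using block_start_comp[OF Suc assms] by metis
qed

lemma block_start_imp_subst_seq:
  assumes "block_start h x z pos"
  shows "subst_seq h x z"
  unfolding subst_seq_def
proof (intro exI[of _ pos] conjI allI)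
  fix n
  obtain i j where ij: "j < length (h (x i))" "n = pos i + of_nat j"
    using assms unfolding block_start_def by blast
  have "factor z (pos i) (length (h (x i))) = h (x i)" using assms unfolding block_start_def by blast
  then have "z n = h (x i) ! j" using ij by (metis nth_factor)
  then show "\<exists>i. \<exists>j < length (h (x i)). n = pos i + of_nat j \<and> z n = h (x i) ! j" using ij by blast
qed (use assms in \<open>auto simp: block_start_def\<close>)

subsection \<open>From eigenvectors to automaticity\<close>

lemma take_drop_factor: "m + k \<le> n \<Longrightarrow> take k (drop m (factor x i n)) = factor x (i + of_nat m) k"
  by (rule nth_equalityI) (auto simp: add.assoc)

lemma not_periodic_two_letters:
  assumes "\<not> periodic (\<tau> \<circ> x)" "range x \<subseteq> A"
  shows "\<exists>a\<in>A. \<exists>b\<in>A. a \<noteq> b"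
proof (rule ccontr)
  assume "\<not> ?thesis"
  then have "x (n + 1) = x n" for n using assms(2) by blast
  then have "periodic (\<tau> \<circ> x)" unfolding periodic_def by (intro exI[of _ 1]) simp
  then show False using assms(1) by contradiction
qed

context primitive_substitution
begin

text \<open>Let \<open>p' / q'\<close> be the common ratio in lowest terms. Iterating it gives
  \<open>q' ^ n * L (s + n) a = p' ^ n * L s a\<close>, so every power of \<open>q'\<close> divides
  the fixed number \<open>L s a\<close>, whence \<open>q' = 1\<close>. Unbounded growth excludes the
  ratio 1.\<close>

lemma proportional_imp_constant_ratio:
  assumes two: "\<exists>a\<in>A. \<exists>b\<in>A. a \<noteq> b"
    and prp: "\<And>a b. a \<in> A \<Longrightarrow> b \<in> A \<Longrightarrow> L (Suc s) a * L s b = L (Suc s) b * L s a"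
  shows "\<exists>k\<ge>2. \<forall>a\<in>A. L (Suc s) a = k * L s a"
proof -
  obtain a b where ab: "a \<in> A" "b \<in> A" "a \<noteq> b" using two by blast
  define p q where "p = L (Suc s) a" and "q = L s a"
  have q0: "q > 0" using L_pos[OF ab(1)] by (simp add: q_def)
  have step: "q * length (iter (Suc s) w) = p * length (iter s w)" if "set w \<subseteq> A" for w
    using that
  proof (induction w)
    case (Cons c w)
    have e: "length (iter n (c # w)) = L n c + length (iter n w)" for n
      using subst_word_pow_append[of n \<phi> "[c]" w] by simp
    have "q * L (Suc s) c = p * L s c"
      using prp[OF _ ab(1), of c] Cons.prems unfolding p_def q_def by (simp only: mult.commute) simp
    then show ?case using Cons unfolding e by (simp only: distrib_left) simp
  qed simp
  have pow: "q ^ n * length (iter (s + n) w) = p ^ n * length (iter s w)" if "set w \<subseteq> A" for n w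
    using that
  proof (induction n arbitrary: w)
    case (Suc n)
    have "q ^ Suc n * length (iter (s + Suc n) w) = q * (q ^ n * length (iter (s + n) (subst_word \<phi> w)))"
      using subst_word_pow_add[of "s + n" 1 \<phi> w] by simp
    also have "\<dots> = q * (p ^ n * length (iter s (subst_word \<phi> w)))"
      using Suc.IH[OF set_subst_word[OF Suc.prems]] by simp
    also have "\<dots> = p ^ n * (q * length (iter (Suc s) w))"
      using subst_word_pow_add[of s 1 \<phi> w] by simp
    also have "\<dots> = p ^ Suc n * length (iter s w)" unfolding step[OF Suc.prems] by simp
    finally show ?case .
  qed simp
  define d where "d = gcd p q"
  have d0: "d > 0" using q0 by (simp add: d_def)
  define p' q' where "p' = p div d" and "q' = q div d"
  have pq': "p = d * p'" "q = d * q'" by (simp_all add: p'_def q'_def d_def)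
  have cop: "coprime p' q'" using q0 unfolding p'_def q'_def d_def by (intro div_gcd_coprime) auto
  have "q' ^ n dvd L s a" for n
  proof -
    have "d ^ n * (q' ^ n * L (s + n) a) = d ^ n * (p' ^ n * L s a)"
      using pow[of "[a]" n] ab(1) d0 unfolding pq' by (simp add: power_mult_distrib)
    then have "q' ^ n * L (s + n) a = p' ^ n * L s a" using d0 by simp
    then have "q' ^ n dvd p' ^ n * L s a" by (metis dvd_triv_left)
    moreover have "coprime (q' ^ n) (p' ^ n)" using cop by (simp add: coprime_commute)
    ultimately show ?thesis using coprime_dvd_mult_right_iff by blast
  qed
  then have le: "q' ^ n \<le> L s a" for n using L_pos[OF ab(1)] by (intro dvd_imp_le)
  have "q' > 0" using q0 pq'(2) by (cases q') auto
  moreover have "\<not> q' \<ge> 2"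
  proof
    assume "2 \<le> q'"
    then have "2 ^ L s a \<le> q' ^ L s a" by (rule power_mono) simp
    then show False using le[of "L s a"] less_exp[of "L s a"] by linarith
  qed
  ultimately have "q' = 1" by linarith
  then have pk: "p = p' * q" using pq' by simp
  have k: "L (Suc s) c = p' * L s c" if "c \<in> A" for c
    using step[of "[c]"] that q0 unfolding pk by (simp add: ac_simps)
  have "p' \<noteq> 0"
  proof
    assume "p' = 0"
    then have "L (Suc s) a = 0" using k[OF ab(1)] by simp
    then show False using L_pos[OF ab(1), of "Suc s"] by (simp only: less_irrefl)
  qed
  moreover have "p' \<noteq> 1"
  proof
    assume "p' = 1"
    then have "p = q" using pk by simp
    then have c: "L (s + n) a = L s a" for n using pow[of "[a]" n] ab(1) q0 by simp
    obtain n where n: "\<And>m. m \<ge> n \<Longrightarrow> Suc (L s a) \<le> L m a"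
      using L_unbounded[OF ab, of "Suc (L s a)"] ab(1) by blast
    show False using n[of "s + n"] c[of n] by simp
  qed
  ultimately have "p' \<ge> 2" by linarith
  then show ?thesis using k by blast
qed

text \<open>Dekking's construction: split every letter \<open>a\<close> into \<open>|\<phi>\<^sup>s(a)|\<close> letters \<open>(a, j)\<close>. The
  corresponding lift of \<open>\<phi>\<close> multiplies lengths by \<open>k\<close>, so it can be cut into pieces of length \<open>k\<close>.\<close>

lemma constant_ratio_imp_k_automatic:
  fixes x :: "'i :: discrete_index \<Rightarrow> 'a"
  assumes "fixed_point A \<phi> x" and k: "k > 0" and ratio: "\<And>a. a \<in> A \<Longrightarrow> L (Suc s) a = k * L s a"
  shows "k_automatic k (\<tau> \<circ> x)"
proof -
  have xA: "x i \<in> A" for i using assms(1) unfolding fixed_point_def by auto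
  obtain pos where pos: "block_start \<phi> x x pos"
    using assms(1) subst_seq_imp_block_start unfolding fixed_point_def by blast
  define p where "p = pos ^^ s"
  have p: "block_start (\<lambda>a. iter s [a]) x x p"
    unfolding p_def by (rule block_start_iterate[OF pos])
  have p_Suc: "\<forall>i. p (i + 1) = p i + of_nat (L s (x i))"
    and p_cover: "\<And>n. \<exists>i. \<exists>j < L s (x i). n = p i + of_nat j"
    and p_factor: "\<And>i. factor x (p i) (L s (x i)) = iter s [x i]"
    using p unfolding block_start_def by blast+
  define W where "W a = map (Pair a) [0..<L s a]" for a
  have lW: "length (W a) = L s a" for a by (simp add: W_def)
  have "\<exists>i j. j < L s (x i) \<and> n = p i + of_nat j" for n using p_cover by blast
  then obtain I J where IJ: "\<And>n. J n < L s (x (I n))" "\<And>n. n = p (I n) + of_nat (J n)" by metis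
  define z where "z n = (x (I n), J n)" for n
  have z: "z (p i + of_nat j) = (x i, j)" if j: "j < L s (x i)" for i j
    using block_unique[where h = W and x = x and pos = p, unfolded lW, OF p_Suc j IJ(1) IJ(2)]
    by (simp add: z_def)
  have Wz: "block_start W x z p"
    unfolding block_start_def lW
  proof (intro conjI allI)
    show "factor z (p i) (L s (x i)) = W (x i)" for i
      by (rule nth_equalityI) (simp_all add: W_def z)
  qed (use p p_cover in \<open>auto simp: block_start_def\<close>)
  define V where "V a = concat (map W (\<phi> a))" for a
  have V: "block_start V x z (p \<circ> pos)" unfolding V_def by (rule block_start_comp[OF pos Wz])
  have lV: "length (V a) = k * L s a" if "a \<in> A" for a
  proof -
    have "length (V a) = L (Suc s) a"
      unfolding V_def subst_word_pow_Suc length_subst_word_pow[of s \<phi> "\<phi> a"]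
      by (simp add: length_concat o_def lW)
    then show ?thesis using ratio[OF that] by simp
  qed
  \<comment> \<open>Both sides vanish at 0 and grow by \<open>k * L s (x i)\<close> from
    \<open>i\<close> to \<open>i + 1\<close>. Therefore the pieces of length \<open>k\<close> cut
    inside each block sit at the multiples of \<open>k\<close> of the whole sequence, also to the
    left of 0.\<close>
  have scale: "(p \<circ> pos) i = of_nat k * p i" for i
  proof (induction i rule: discrete_index_induct)
    case zero
    show ?case using V p unfolding block_start_def by simp
  next
    have s: "(p \<circ> pos) (i + 1) = (p \<circ> pos) i + of_nat (k * L s (x i))" for i
      using V lV[OF xA[of i]] unfolding block_start_def by metis
    {
      case (up i)
      show ?case unfolding s up using p_Suc by (simp add: distrib_left)
    next
      case (down i)
      then show ?case unfolding s using p_Suc by (simp add: distrib_left)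
    }
  qed
  define \<psi> where "\<psi> c = take k (drop (snd c * k) (V (fst c)))" for c
  define C where "C = Sigma A (\<lambda>a. {..<L s a})"
  have zC: "z n \<in> C" for n using IJ(1) xA by (simp add: C_def z_def)
  have fin: "finite C" unfolding C_def using finite_A by simp
  have bound: "j * k + k \<le> k * L s a" if "j < L s a" for j a
    using mult_le_mono2[of "Suc j" "L s a" k] that by (simp add: mult.commute)
  have l\<psi>: "length (\<psi> c) = k" if "c \<in> C" for c
    using that lV[of "fst c"] bound[of "snd c" "fst c"] by (auto simp: C_def \<psi>_def)
  have "set (V a) \<subseteq> C" if "a \<in> A" for a
    using subst_closed[OF that] by (auto simp: V_def W_def C_def)
  then have \<psi>C: "set (\<psi> c) \<subseteq> C" if "c \<in> C" for c
    using that set_take_subset[of k "drop (snd c * k) (V (fst c))"]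
      set_drop_subset[of "snd c * k" "V (fst c)"]
    unfolding \<psi>_def C_def by fastforce
  have z\<psi>: "factor z (of_nat k * n) k = \<psi> (z n)" for n
  proof -
    let ?a = "x (I n)"
    have "factor z ((p \<circ> pos) (I n)) (k * L s ?a) = V ?a"
      using V lV[OF xA[of "I n"]] unfolding block_start_def by metis
    then have "\<psi> (z n) = take k (drop (J n * k) (factor z ((p \<circ> pos) (I n)) (k * L s ?a)))"
      by (simp add: \<psi>_def z_def)
    also have "\<dots> = factor z (of_nat k * p (I n) + of_nat (J n * k)) k"
      unfolding scale using bound[OF IJ(1)[of n]] by (rule take_drop_factor)
    also have "of_nat k * p (I n) + of_nat (J n * k) = of_nat k * n"
      by (subst (3) IJ(2)) (simp add: distrib_left mult.commute)
    finally show ?thesis ..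
  qed
  \<comment> \<open>The letters are renamed by numbers, as \<open>k_automatic\<close> asks for an
    alphabet of natural numbers.\<close>
  obtain f :: "'a \<times> nat \<Rightarrow> nat" where f: "inj_on f C"
    using finite_imp_inj_to_nat_seg[OF fin] by blast
  let ?g = "inv_into C f"
  let ?\<psi> = "\<lambda>c. map f (\<psi> (?g c))"
  have g: "?g (f c) = c" if "c \<in> C" for c using f that by simp
  have "block_start ?\<psi> (f \<circ> z) (f \<circ> z) (\<lambda>n. of_nat k * n)"
    unfolding block_start_def
  proof (intro conjI allI)
    fix n :: 'i
    have e: "?\<psi> ((f \<circ> z) n) = map f (\<psi> (z n))" for n using g[OF zC] by simp
    show "of_nat k * (n + 1) = of_nat k * n + of_nat (length (?\<psi> ((f \<circ> z) n)))"
      unfolding e using l\<psi>[OF zC] by (simp add: distrib_left)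
    show "factor (f \<circ> z) (of_nat k * n) (length (?\<psi> ((f \<circ> z) n))) = ?\<psi> ((f \<circ> z) n)"
      unfolding e length_map l\<psi>[OF zC] by (simp only: z\<psi>[symmetric] map_factor)
    show "\<exists>i. \<exists>j < length (?\<psi> ((f \<circ> z) i)). n = of_nat k * i + of_nat j"
    proof -
      obtain i j where ij: "j < length (V (x i))" "n = (p \<circ> pos) i + of_nat j"
        using V unfolding block_start_def by blast
      have "j = k * (j div k) + j mod k" by simp
      then have "(of_nat j :: 'i) = of_nat k * of_nat (j div k) + of_nat (j mod k)"
        by (metis of_nat_add of_nat_mult)
      then have "n = of_nat k * (p i + of_nat (j div k)) + of_nat (j mod k)"
        unfolding ij(2) scale by (simp add: distrib_left add.assoc)
      moreover have "j mod k < k" using k by simp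
      ultimately show ?thesis unfolding e length_map l\<psi>[OF zC] by blast
    qed
  qed simp
  then have "subst_seq ?\<psi> (f \<circ> z) (f \<circ> z)" by (rule block_start_imp_subst_seq)
  then have fixed: "fixed_point (f ` C) ?\<psi> (f \<circ> z)" using zC unfolding fixed_point_def by auto
  have sub: "substitution (f ` C) ?\<psi>" unfolding substitution_def using \<psi>C g by fastforce
  have const: "constant_length (f ` C) k ?\<psi>" unfolding constant_length_def using l\<psi> g by simp
  \<comment> \<open>The pair \<open>(a, j)\<close> stands for the \<open>j\<close>-th letter of
    \<open>iter s [a]\<close>.\<close>
  let ?\<pi> = "\<lambda>c. \<tau> (iter s [fst (?g c)] ! snd (?g c))"
  have "(\<tau> \<circ> x) n = (?\<pi> \<circ> (f \<circ> z)) n" for n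
  proof -
    have "x n = factor x (p (I n)) (L s (x (I n))) ! J n"
      using IJ(1)[of n] IJ(2)[of n] by simp
    then show ?thesis using g[OF zC[of n]] unfolding p_factor by (simp add: z_def)
  qed
  then have "\<tau> \<circ> x = ?\<pi> \<circ> (f \<circ> z)" by blast
  with fin sub const fixed show ?thesis unfolding k_automatic_def by blast
qed

end

subsection \<open>From automaticity to eigenvectors\<close>

lemma sublist_subst_word_pow: "sublist u v \<Longrightarrow> sublist ((subst_word \<phi> ^^ n) u) ((subst_word \<phi> ^^ n) v)"
  unfolding sublist_def by (metis subst_word_pow_append)

text \<open>The assumption \<open>factors\<close> is the only place where the two kinds of sequences
  differ: a one-sided fixed point satisfies it by growth from its first letter, a two-sided one by
  admissibility.\<close>

locale primitive_fixed_point = primitive_substitution A \<phi> for A :: "'a set" and \<phi> +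
  fixes x :: "'i :: discrete_index \<Rightarrow> 'a" and pos :: "'i \<Rightarrow> 'i"
  assumes range_x: "x i \<in> A" and blocks: "block_start \<phi> x x pos"
    and factors: "\<exists>b\<in>A. \<exists>n. sublist (factor x i d) ((subst_word \<phi> ^^ n) [b])"
begin

lemma set_factor_x: "set (factor x i d) \<subseteq> A"
  using range_x set_factor[of x i d] by blast

lemma block_start_pow: "block_start (\<lambda>a. iter n [a]) x x (pos ^^ n)"
  by (rule block_start_iterate[OF blocks])

lemma factor_iter: "factor x ((pos ^^ n) i) (length (iter n (factor x i d))) = iter n (factor x i d)"
  using block_start_factor[OF block_start_pow, of n i d]
  unfolding subst_word_pow_eq_concat[of n \<phi> "factor x i d"] .

lemma pos_pow_Suc: "(pos ^^ n) (i + 1) = (pos ^^ n) i + of_nat (L n (x i))"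
  using block_start_pow[of n] unfolding block_start_def by blast

lemma pos_pow_cover: obtains j t where "t < L n (x j)" "i = (pos ^^ n) j + of_nat t"
  using block_start_pow[of n] unfolding block_start_def by blast

text \<open>The incomplete block at the left end accounts for the extra \<open>B\<close>; the next
  \<open>e\<close> blocks take at most \<open>e * B\<close>.\<close>

lemma long_factor_contains_blocks:
  assumes B: "\<And>a. a \<in> A \<Longrightarrow> L n a \<le> B" and d: "(e + 1) * B \<le> d"
  shows "\<exists>j. sublist (iter n (factor x j e)) (factor x i d)"
proof -
  obtain j t where jt: "t < L n (x j)" "i = (pos ^^ n) j + of_nat t" by (rule pos_pow_cover)
  define m where "m = L n (x j) - t"
  have "(pos ^^ n) (j + 1) = i + of_nat m"
    unfolding pos_pow_Suc jt(2) m_def using jt(1) by (simp add: add.assoc flip: of_nat_add)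
  moreover have "length (iter n w) \<le> length w * B" if "set w \<subseteq> A" for w
    using that
  proof (induction w)
    case (Cons c w)
    then show ?case using B[of c] subst_word_pow_append[of n \<phi> "[c]" w] by simp
  qed simp
  then have "length (iter n (factor x (j + 1) e)) \<le> e * B" using set_factor_x by (metis length_factor)
  moreover have "m \<le> B" using B[OF range_x] unfolding m_def by (meson diff_le_self order_trans)
  ultimately have "sublist (factor x ((pos ^^ n) (j + 1)) (length (iter n (factor x (j + 1) e)))) (factor x i d)"
    using d by (auto intro!: sublist_factor)
  then show ?thesis unfolding factor_iter by blast
qed

lemma short_factor_in_two_blocks:
  assumes "\<And>a. a \<in> A \<Longrightarrow> l \<le> L n a"
  shows "\<exists>j. sublist (factor x i l) (iter n (factor x j 2))"
proof -
  obtain j t where jt: "t < L n (x j)" "i = (pos ^^ n) j + of_nat t" by (rule pos_pow_cover)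
  have f: "factor x j 2 = [x j] @ [x (j + 1)]" by (simp add: factor_def upt_rec)
  have "length (iter n (factor x j 2)) = L n (x j) + L n (x (j + 1))"
    unfolding f subst_word_pow_append by simp
  then have "t + l \<le> length (iter n (factor x j 2))" using jt(1) assms[OF range_x, of "j + 1"] by simp
  then have "sublist (factor x i l) (factor x ((pos ^^ n) j) (length (iter n (factor x j 2))))"
    unfolding jt(2) by (rule sublist_factor)
  then show ?thesis unfolding factor_iter by blast
qed

text \<open>A factor occurs in some iterate of one letter, hence by primitivity in a fixed iterate
  of every letter, and each long window contains a whole block of that iterate.\<close>

lemma uniformly_recurrent_factor: "\<exists>N. \<forall>j. \<forall>n\<ge>N. sublist (factor x i d) (factor x j n)"
proof -
  obtain b m where b: "b \<in> A" "sublist (factor x i d) (iter m [b])" using factors by blast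
  obtain k where k: "\<And>a. a \<in> A \<Longrightarrow> A \<subseteq> set (iter k [a])" using all_letters by blast
  have sub: "sublist (factor x i d) (iter (m + k) [a])" if "a \<in> A" for a
  proof -
    have "b \<in> set (iter k [a])" using k[OF that] b(1) by blast
    then have "sublist [b] (iter k [a])" by (auto simp: in_set_conv_decomp sublist_def)
    then show ?thesis unfolding subst_word_pow_add
      using b(2) sublist_subst_word_pow sublist_order.order_trans by blast
  qed
  define B where "B = Max (L (m + k) ` A)"
  have B: "L (m + k) a \<le> B" if "a \<in> A" for a unfolding B_def using finite_A that by (intro Max_ge) auto
  have "sublist (factor x i d) (factor x j n)" if n: "n \<ge> (1 + 1) * B" for j n
  proof -
    obtain l where "sublist (iter (m + k) (factor x l 1)) (factor x j n)"
      using long_factor_contains_blocks[OF B n] by blast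
    moreover have "factor x l 1 = [x l]" by (simp add: factor_1)
    ultimately show ?thesis using sub[OF range_x] sublist_order.order_trans by metis
  qed
  then show ?thesis by blast
qed

lemma uniformly_recurrent_length: "\<exists>N. \<forall>i j. sublist (factor x i d) (factor x j N)"
proof -
  let ?F = "{factor x i d |i. True}"
  have "finite ?F"
    by (rule finite_subset[OF _ finite_lists_length_eq[OF finite_A, of d]]) (use set_factor_x in auto)
  moreover have "\<forall>u\<in>?F. \<exists>N. \<forall>j. \<forall>n\<ge>N. sublist u (factor x j n)"
    using uniformly_recurrent_factor by blast
  then obtain N where N: "\<And>u j n. u \<in> ?F \<Longrightarrow> n \<ge> N u \<Longrightarrow> sublist u (factor x j n)" by metis
  ultimately have "N u \<le> Max (N ` ?F)" if "u \<in> ?F" for u using that by (intro Max_ge) auto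
  then have "sublist (factor x i d) (factor x j (Max (N ` ?F)))" for i j using N by blast
  then show ?thesis by blast
qed

text \<open>A sufficiently high power of a word \<open>u\<close> contains all factors of length \<open>|u| + 1\<close>, which then
  begin and end with the same letter.\<close>

lemma bounded_powers:
  assumes "\<not> periodic (\<tau> \<circ> x)"
  shows "\<exists>Q. \<forall>i P l. P > 0 \<longrightarrow> (\<forall>t<l. (\<tau> \<circ> x) (i + of_nat t) = (\<tau> \<circ> x) (i + of_nat (P + t))) \<longrightarrow> l < Q * P"
proof -
  obtain K where K: "\<And>n a b. a \<in> A \<Longrightarrow> b \<in> A \<Longrightarrow> L (Suc n) a \<le> K * L n b" using L_Suc_le by blast
  obtain N where N: "\<And>i j. sublist (factor x i 2) (factor x j N)"
    using uniformly_recurrent_length by blast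
  obtain a0 b0 where ab: "a0 \<in> A" "b0 \<in> A" "a0 \<noteq> b0"
    using not_periodic_two_letters[OF assms] range_x by blast
  have "l < (N + 1) * K * P" if P: "P > 0"
    and eq: "\<forall>t<l. (\<tau> \<circ> x) (i + of_nat t) = (\<tau> \<circ> x) (i + of_nat (P + t))" for i P l
  proof (rule ccontr)
    assume "\<not> ?thesis"
    then have l: "(N + 1) * (K * P) \<le> l" by (simp only: mult.assoc not_less)
    \<comment> \<open>All blocks of level \<open>n\<close> are longer than \<open>P\<close>, so a
      window of length \<open>Suc P\<close> fits into two of them; by minimality of \<open>n\<close>
      and comparability they are no longer than \<open>K * P\<close>. The repetition thus contains
      \<open>N\<close> consecutive blocks, enough for all pairs of neighbours.\<close>
    define n where "n = (LEAST n. \<forall>a\<in>A. Suc P \<le> L n a)"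
    have "\<exists>n. \<forall>a\<in>A. Suc P \<le> L n a" using L_unbounded[OF ab, of "Suc P"] by blast
    then have n: "\<forall>a\<in>A. Suc P \<le> L n a" unfolding n_def by (rule LeastI_ex)
    have "n \<noteq> 0"
    proof
      assume "n = 0"
      then show False using n ab(1) P by auto
    qed
    then obtain n' where n': "n = Suc n'" by (cases n) auto
    then have "n' < (LEAST n. \<forall>a\<in>A. Suc P \<le> L n a)" unfolding n_def by linarith
    then have "\<not> (\<forall>a\<in>A. Suc P \<le> L n' a)" by (rule not_less_Least)
    then obtain b where b: "b \<in> A" "L n' b \<le> P" by (auto simp: not_less_eq_eq)
    have B: "L n a \<le> K * P" if "a \<in> A" for a
      unfolding n' using K[OF that b(1), of n'] b(2) by (meson le_trans mult_le_mono2)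
    obtain j where j: "sublist (iter n (factor x j N)) (factor x i l)"
      using long_factor_contains_blocks[OF B l] by blast
    have "(\<tau> \<circ> x) (t + of_nat P) = (\<tau> \<circ> x) t" for t
    proof -
      obtain j' where "sublist (factor x t (Suc P)) (iter n (factor x j' 2))"
        using short_factor_in_two_blocks n by blast
      then have "sublist (factor x t (Suc P)) (factor x i l)"
        using N sublist_subst_word_pow j sublist_order.order_trans by metis
      then obtain m where m: "m + Suc P \<le> l" "factor x t (Suc P) = factor x (i + of_nat m) (Suc P)"
        by (elim sublist_factorE) simp
      have x: "x (t + of_nat r) = x (i + of_nat (m + r))" if "r \<le> P" for r
        using arg_cong[OF m(2), of "\<lambda>w. w ! r"] that by (simp add: add.assoc)
      have "(\<tau> \<circ> x) (t + of_nat P) = (\<tau> \<circ> x) (i + of_nat (P + m))"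
        using x[of P] by (simp add: add.commute)
      also have "\<dots> = (\<tau> \<circ> x) (i + of_nat m)" using eq m(1) by simp
      also have "\<dots> = (\<tau> \<circ> x) t" using x[of 0] by simp
      finally show ?thesis .
    qed
    moreover have "(of_nat P :: 'i) > 0" using P by simp
    ultimately show False using assms unfolding periodic_def by blast
  qed
  then show ?thesis by blast
qed

lemma letter_occurs: assumes "a \<in> A" shows "\<exists>i. x i = a"
proof -
  obtain k where k: "\<And>a. a \<in> A \<Longrightarrow> A \<subseteq> set (iter k [a])" using all_letters by blast
  have "factor x 0 1 = [x 0]" by (simp add: factor_1)
  then have "a \<in> set (iter k (factor x 0 1))" using k[OF range_x] assms by auto
  then have "a \<in> set (factor x ((pos ^^ k) 0) (length (iter k (factor x 0 1))))"
    unfolding factor_iter .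
  then have "a \<in> range x" by (rule subsetD[OF set_factor])
  then show ?thesis by auto
qed

text \<open>Every block of level \<open>Suc n\<close> begins with \<open>iter n [c]\<close>. Two
  consecutive block starts, the first belonging to an occurrence of \<open>a\<close>, are
  \<open>L (Suc n) a\<close> apart.\<close>

lemma left_proper_return:
  assumes c: "\<And>b. b \<in> A \<Longrightarrow> hd (\<phi> b) = c" and "a \<in> A"
  shows "\<exists>i. \<forall>t < L n c. x (i + of_nat t) = x (i + of_nat (L (Suc n) a + t))"
proof -
  have start: "x ((pos ^^ Suc n) j + of_nat t) = iter n [c] ! t" if "t < L n c" for j t
  proof -
    have "\<phi> (x j) = [c] @ tl (\<phi> (x j))" using c[OF range_x] nonerasing[OF range_x] by (metis append_Cons append_Nil list.collapse)
    then have e: "iter (Suc n) [x j] = iter n [c] @ iter n (tl (\<phi> (x j)))"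
      unfolding subst_word_pow_Suc by (metis subst_word_pow_append)
    have "factor x ((pos ^^ Suc n) j) (L (Suc n) (x j)) = iter (Suc n) [x j]"
      using factor_iter[of "Suc n" j 1] by (simp only: One_nat_def factor_1)
    then have "factor x ((pos ^^ Suc n) j) (L (Suc n) (x j)) ! t = iter n [c] ! t"
      using that unfolding e by (simp add: nth_append)
    moreover have "t < L (Suc n) (x j)" using that unfolding e by simp
    ultimately show ?thesis by simp
  qed
  obtain j where j: "x j = a" using letter_occurs[OF assms(2)] by blast
  have "x ((pos ^^ Suc n) j + of_nat t) = x ((pos ^^ Suc n) j + of_nat (L (Suc n) a + t))" if "t < L n c" for t
    using start[OF that, of j] start[OF that, of "j + 1"] unfolding pos_pow_Suc j
    by (simp only: of_nat_add add.assoc)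
  then show ?thesis by blast
qed

text \<open>The scale \<open>m\<close> is tied to \<open>n\<close> by making \<open>k ^ m\<close>
  comparable with \<open>L n c\<close>: small enough that the return of \<open>iter n [c]\<close> is
  recognized, large enough that \<open>g\<close>, which is at least a fixed fraction of
  \<open>k ^ m\<close>, is comparable with all lengths at level \<open>Suc n\<close>.\<close>

lemma common_divisor:
  fixes \<tau> :: "'a \<Rightarrow> 'b"
  assumes y: "\<not> periodic (\<tau> \<circ> x)" and aut: "k_automatic k (\<tau> \<circ> x)" and k: "k \<ge> 2"
    and c: "\<And>b. b \<in> A \<Longrightarrow> hd (\<phi> b) = c" "c \<in> A"
  shows "\<exists>E n0. \<forall>n\<ge>n0. \<exists>g>0. \<forall>a\<in>A. g dvd L (Suc n) a \<and> L (Suc n) a \<le> E * g"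
proof -
  obtain C :: "nat set" and \<psi> \<pi> z where aut: "finite C" "substitution C \<psi>" "constant_length C k \<psi>"
    "fixed_point C \<psi> z" "\<tau> \<circ> x = \<pi> \<circ> z"
    using aut unfolding k_automatic_def by blast
  have zC: "range z \<subseteq> C" using aut(4) unfolding fixed_point_def by blast
  obtain pz where pz: "block_start \<psi> z z pz"
    using aut(4) subst_seq_imp_block_start unfolding fixed_point_def by blast
  let ?E = "{factor z i d |i d. True}"
  have E: "language C ?E" unfolding language_def
  proof (intro conjI ballI allI impI)
    show "?E \<subseteq> lists C" using zC set_factor by fastforce
    show "v \<in> ?E" if "u \<in> ?E" "sublist v u" for u v
      using that by (elim CollectE exE conjE) (metis (mono_tags, lifting) mem_Collect_eq sublist_factorE)
    show "\<exists>u\<in>?E. length u = n" for n by force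
  qed
  obtain D where D: "D \<subseteq> ?E" "language C D" "uniformly_recurrent D"
    using uniformly_recurrent_sublanguage[OF aut(1) E] by blast
  define h where "h m c = map \<pi> ((subst_word \<psi> ^^ m) [c])" for m c
  have len: "length ((subst_word \<psi> ^^ m) w) = k ^ m * length w" if "set w \<subseteq> C" for m w
    using that
  proof (induction m arbitrary: w)
    case (Suc m)
    have "set (subst_word \<psi> w) \<subseteq> C" "length (subst_word \<psi> w) = k * length w"
      using Suc.prems aut(2,3)
      by (induction w) (auto simp: subst_word_def substitution_def constant_length_def)
    then show ?case using Suc.IH[of "subst_word \<psi> w"] by (simp add: funpow_swap1)
  qed simp
  have lenh: "\<forall>c\<in>C. length (h m c) = k ^ m" for m using len[of "[_]" m] by (simp add: h_def)
  have H: "\<exists>i. concat (map (h m) u) = factor (\<tau> \<circ> x) i (k ^ m * length u)" if u: "u \<in> D" for m u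
  proof -
    obtain i d where id: "u = factor z i d" using D(1) u by blast
    have uC: "set u \<subseteq> C" using language_letters[OF D(2) u] .
    have "concat (map (h m) u) = map \<pi> ((subst_word \<psi> ^^ m) u)"
      by (subst subst_word_pow_eq_concat) (simp add: h_def[abs_def] map_concat o_def)
    also have "(subst_word \<psi> ^^ m) u = factor z ((pz ^^ m) i) (length ((subst_word \<psi> ^^ m) u))"
      using block_start_factor[OF block_start_iterate[OF pz], of m i d]
      unfolding id subst_word_pow_eq_concat[of m \<psi> "factor z i d"] by (rule sym)
    finally show ?thesis unfolding len[OF uC] map_factor aut(5) by blast
  qed
  obtain Q where Q: "\<And>i P l. P > 0 \<Longrightarrow> \<forall>t<l. (\<tau> \<circ> x) (i + of_nat t) = (\<tau> \<circ> x) (i + of_nat (P + t)) \<Longrightarrow> l < Q * P"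
    using bounded_powers[OF y] by blast
  have nopow: "\<forall>u\<in>D. \<forall>p P l. P > 0 \<longrightarrow> p + P + l \<le> length (concat (map (h m) u)) \<longrightarrow>
        (\<forall>t<l. concat (map (h m) u) ! (p + t) = concat (map (h m) u) ! (p + P + t)) \<longrightarrow> l < Q * P" for m
  proof (intro ballI allI impI)
    fix u p P l
    assume u: "u \<in> D" and P: "P > 0" and le: "p + P + l \<le> length (concat (map (h m) u))"
      and eq: "\<forall>t<l. concat (map (h m) u) ! (p + t) = concat (map (h m) u) ! (p + P + t)"
    obtain i where i: "concat (map (h m) u) = factor (\<tau> \<circ> x) i (k ^ m * length u)" using H[OF u] by blast
    have le': "p + P + l \<le> k ^ m * length u" using le unfolding i by simp
    have "(\<tau> \<circ> x) (i + of_nat p + of_nat t) = (\<tau> \<circ> x) (i + of_nat p + of_nat (P + t))" if "t < l" for t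
      using eq[rule_format, OF that] le' that unfolding i
      by (simp add: add.assoc)
    then show "l < Q * P" using Q[OF P] by blast
  qed
  have km: "k ^ m > 0" for m using k by simp
  from uniform_recognizability[OF aut(1) D(2,3)] obtain T
    where T: "\<forall>(h :: nat \<Rightarrow> 'b list) N Q. N > 0 \<longrightarrow> (\<forall>c\<in>C. length (h c) = N) \<longrightarrow>
     (\<forall>u\<in>D. \<forall>p P l. P > 0 \<longrightarrow> p + P + l \<le> length (concat (map h u)) \<longrightarrow>
        (\<forall>t<l. concat (map h u) ! (p + t) = concat (map h u) ! (p + P + t)) \<longrightarrow> l < Q * P) \<longrightarrow>
     (\<exists>g>0. N \<le> Suc Q * card C * g \<and>
       (\<forall>u\<in>D. \<forall>p q l. p \<le> q \<longrightarrow> q + l \<le> length (concat (map h u)) \<longrightarrow> T * N \<le> l \<longrightarrow>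
          (\<forall>t<l. concat (map h u) ! (p + t) = concat (map h u) ! (q + t)) \<longrightarrow> g dvd q - p))" ..
  have dvd: "\<exists>g>0. k ^ m \<le> Suc Q * card C * g \<and> (\<forall>n. \<forall>a\<in>A. T * k ^ m \<le> L n c \<longrightarrow> g dvd L (Suc n) a)" for m
  proof -
    obtain g where g: "g > 0" "k ^ m \<le> Suc Q * card C * g"
      "\<And>u p q l. u \<in> D \<Longrightarrow> p \<le> q \<Longrightarrow> q + l \<le> length (concat (map (h m) u)) \<Longrightarrow> T * k ^ m \<le> l \<Longrightarrow>
        \<forall>t<l. concat (map (h m) u) ! (p + t) = concat (map (h m) u) ! (q + t) \<Longrightarrow> g dvd q - p"
      using mp[OF mp[OF mp[OF T[THEN spec[of _ "h m"], THEN spec[of _ "k ^ m"], THEN spec[of _ Q]] km] lenh] nopow] by blast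
    have "g dvd L (Suc n) a" if a: "a \<in> A" and n: "T * k ^ m \<le> L n c" for n a
    proof -
      obtain i where i: "\<forall>t < L n c. x (i + of_nat t) = x (i + of_nat (L (Suc n) a + t))"
        using left_proper_return[OF c(1) a] by blast
      let ?d = "L (Suc n) a + L n c"
      \<comment> \<open>The return is known somewhere in \<open>x\<close>, while recognizability
        speaks of images of words of \<open>D\<close>. These images are factors of \<tau> \<circ> x,
        and a long one covers another occurrence of the same factor of \<open>x\<close>.\<close>
      obtain N where N: "\<And>j n. n \<ge> N \<Longrightarrow> sublist (factor x i ?d) (factor x j n)"
        using uniformly_recurrent_factor[of i ?d] by blast
      obtain u where u: "u \<in> D" "length u = N" using D(2) unfolding language_def by blast
      obtain j where j: "concat (map (h m) u) = factor (\<tau> \<circ> x) j (k ^ m * length u)" using H[OF u(1)] by blast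
      have "N \<le> k ^ m * length u" using u(2) k by simp
      then have "sublist (factor x i ?d) (factor x j (k ^ m * length u))" by (rule N)
      then obtain r where r: "r + ?d \<le> k ^ m * length u" "factor x i ?d = factor x (j + of_nat r) ?d"
        by (rule sublist_factorE) (simp only: length_factor)
      have x: "x (j + of_nat (r + t)) = x (i + of_nat t)" if "t < ?d" for t
        using arg_cong[OF r(2), of "\<lambda>w. w ! t"] that by (simp only: nth_factor of_nat_add add.assoc)
      have "g dvd (r + L (Suc n) a) - r"
      proof (rule g(3)[OF u(1) _ _ n])
        show "r + L (Suc n) a + L n c \<le> length (concat (map (h m) u))" unfolding j using r(1) by simp
        show "\<forall>t<L n c. concat (map (h m) u) ! (r + t) = concat (map (h m) u) ! (r + L (Suc n) a + t)"
        proof (intro allI impI)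
          fix t assume t: "t < L n c"
          have "x (j + of_nat (r + t)) = x (j + of_nat (r + (L (Suc n) a + t)))"
            using x[of t] x[of "L (Suc n) a + t"] i t by simp
          then show "concat (map (h m) u) ! (r + t) = concat (map (h m) u) ! (r + L (Suc n) a + t)"
            unfolding j add.assoc[of r] using r(1) t by (simp only: nth_factor o_apply)
        qed
      qed simp
      then show ?thesis by simp
    qed
    then show ?thesis using g(1,2) by blast
  qed
  obtain K where K: "\<And>n a b. a \<in> A \<Longrightarrow> b \<in> A \<Longrightarrow> L (Suc n) a \<le> K * L n b" using L_Suc_le by blast
  obtain a0 b0 where ab: "a0 \<in> A" "b0 \<in> A" "a0 \<noteq> b0"
    using not_periodic_two_letters[OF y] range_x by blast
  obtain n0 where n0: "\<And>n. n \<ge> n0 \<Longrightarrow> Suc T \<le> L n c" using L_unbounded[OF ab, of "Suc T"] c(2) by blast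
  have "\<exists>g>0. \<forall>a\<in>A. g dvd L (Suc n) a \<and> L (Suc n) a \<le> (K * (Suc T * k * (Suc Q * card C))) * g"
    if n: "n \<ge> n0" for n
  proof -
    \<comment> \<open>The largest \<open>m\<close> with \<open>Suc T * k ^ m \<le> L n c\<close>;
      \<open>n0\<close> guarantees this for \<open>m = 0\<close>. Using \<open>Suc T\<close> keeps
      the factor positive even if \<open>T = 0\<close>.\<close>
    define m where "m = (LEAST m. L n c < Suc T * k ^ Suc m)"
    have "L n c < Suc T * k ^ Suc (L n c)"
    proof -
      have "L n c < 2 ^ L n c" by (rule less_exp)
      also have "\<dots> \<le> k ^ L n c" using k by (rule power_mono) simp
      also have "\<dots> \<le> k ^ Suc (L n c)" using k by (intro power_increasing) simp_all
      also have "\<dots> \<le> Suc T * k ^ Suc (L n c)" by simp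
      finally show ?thesis .
    qed
    then have up: "L n c < Suc T * k ^ Suc m" unfolding m_def by (rule LeastI)
    have low: "Suc T * k ^ m \<le> L n c"
    proof (cases m)
      case 0 then show ?thesis using n0[OF n] by simp
    next
      case (Suc m')
      then have "\<not> L n c < Suc T * k ^ Suc m'" using not_less_Least[of m' "\<lambda>m. L n c < Suc T * k ^ Suc m"]
        unfolding m_def by simp
      then show ?thesis using Suc by simp
    qed
    obtain g where g: "g > 0" "k ^ m \<le> Suc Q * card C * g"
      "\<And>a. a \<in> A \<Longrightarrow> T * k ^ m \<le> L n c \<Longrightarrow> g dvd L (Suc n) a" using dvd[of m] by blast
    have "L (Suc n) a \<le> (K * (Suc T * k * (Suc Q * card C))) * g" if "a \<in> A" for a
    proof -
      have "L (Suc n) a \<le> K * L n c" by (rule K[OF that c(2)])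
      also have "\<dots> \<le> K * (Suc T * k * k ^ m)" using less_imp_le[OF up] by (intro mult_le_mono2) (simp only: power_Suc mult.assoc)
      also have "\<dots> \<le> K * (Suc T * k * (Suc Q * card C * g))" using g(2) by (intro mult_le_mono2)
      finally show ?thesis by (simp only: mult.assoc)
    qed
    moreover have "T * k ^ m \<le> L n c" using low by simp
    ultimately show ?thesis using g by blast
  qed
  then show ?thesis by blast
qed

text \<open>The quotients by \<open>G n\<close> form functions from \<open>A\<close> to
  \<open>{..E}\<close>, a finite set once they are restricted to \<open>A\<close>. If the indices
  \<open>n < m\<close> share a function, the length vectors at \<open>Suc n\<close> and
  \<open>Suc m\<close> are both multiples of it, and \<open>proportional_Suc\<close> with step
  \<open>m - n\<close> makes the indices adjacent.\<close>

lemma k_automatic_imp_proportional: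
  assumes y: "\<not> periodic (\<tau> \<circ> x)" and aut: "k_automatic k (\<tau> \<circ> x)" and k: "k \<ge> 2"
    and c: "\<And>b. b \<in> A \<Longrightarrow> hd (\<phi> b) = c"
  shows "\<exists>n. \<forall>a\<in>A. \<forall>b\<in>A. L (Suc n) a * L n b = L (Suc n) b * L n a"
proof -
  obtain b where b: "b \<in> A" using A_nonempty by blast
  have "c \<in> A" using c[OF b] nonerasing[OF b] subst_closed[OF b] hd_in_set by blast
  from common_divisor[OF y aut k c this] obtain E n0 where
    "\<forall>n\<in>{n0..}. \<exists>g>0. \<forall>a\<in>A. g dvd L (Suc n) a \<and> L (Suc n) a \<le> E * g" by auto
  from bchoice[OF this] obtain G where G: "\<And>n. n \<ge> n0 \<Longrightarrow> G n > 0"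
    "\<And>n a. n \<ge> n0 \<Longrightarrow> a \<in> A \<Longrightarrow> G n dvd L (Suc n) a"
    "\<And>n a. n \<ge> n0 \<Longrightarrow> a \<in> A \<Longrightarrow> L (Suc n) a \<le> E * G n" by auto
  define F where "F n = restrict (\<lambda>a. L (Suc n) a div G n) A" for n
  have "F n \<in> A \<rightarrow>\<^sub>E {..E}" if n: "n \<ge> n0" for n
  proof -
    have "L (Suc n) a div G n \<le> E" if "a \<in> A" for a
      using div_le_mono[OF G(3)[OF n that], of "G n"] G(1)[OF n] by (simp only: nonzero_mult_div_cancel_right)
    then show ?thesis unfolding F_def by auto
  qed
  then have "F ` {n0..} \<subseteq> A \<rightarrow>\<^sub>E {..E}" by auto
  then have "finite (F ` {n0..})" by (rule finite_subset) (intro finite_PiE finite_A finite_atMost)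
  then have "\<exists>n\<in>{n0..}. infinite {m\<in>{n0..}. F m = F n}"
    by (intro pigeonhole_infinite) (simp_all add: infinite_Ici)
  then obtain n where n: "n \<ge> n0" "infinite {m\<in>{n0..}. F m = F n}" by auto
  obtain m where m: "m > n" "F m = F n" using n(2) unfolding finite_nat_set_iff_bounded_le by (auto simp: not_le)
  have F: "L (Suc l) a = F l a * G l" if "a \<in> A" "l \<ge> n0" for a l
    using G(2)[OF that(2,1)] that(1) by (simp add: F_def)
  have "L (Suc n + (m - n)) a * L (Suc n) b = L (Suc n + (m - n)) b * L (Suc n) a" if "a \<in> A" "b \<in> A" for a b
  proof -
    have e: "Suc n + (m - n) = Suc m" using m(1) by simp
    show ?thesis unfolding e F[OF that(1) n(1)] F[OF that(2) n(1)]
      F[OF that(1) order_trans[OF n(1) less_imp_le[OF m(1)]]]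
      F[OF that(2) order_trans[OF n(1) less_imp_le[OF m(1)]]] m(2) by simp
  qed
  moreover have "m - n \<ge> 1" using m(1) by simp
  ultimately show ?thesis using proportional_Suc[of "m - n" "Suc n"] by blast
qed

end

section \<open>One-sided and two-sided fixed points, and the equivalence\<close>

context primitive_substitution
begin

lemma block_start_pow_0: "block_start \<phi> x x pos \<Longrightarrow> (pos ^^ n) 0 = 0"
  by (induction n) (simp_all add: block_start_def)

text \<open>Block starts fix 0, so \<open>iter n [x 0]\<close> is a prefix of \<open>x\<close>, and
  its length is unbounded.\<close>

lemma one_sided_factor:
  fixes x :: "nat \<Rightarrow> 'a"
  assumes x: "fixed_point A \<phi> x" and two: "\<exists>a\<in>A. \<exists>b\<in>A. a \<noteq> b"
  shows "\<exists>b\<in>A. \<exists>n. sublist (factor x i d) (iter n [b])"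
proof -
  have x0: "x 0 \<in> A" using x unfolding fixed_point_def by auto
  obtain pos where pos: "block_start \<phi> x x pos"
    using x subst_seq_imp_block_start unfolding fixed_point_def by blast
  obtain n where n: "i + d \<le> L n (x 0)" using two L_unbounded[of _ _ "i + d"] x0 by blast
  have "sublist (factor x (0 + of_nat i) d) (factor x 0 (L n (x 0)))" by (rule sublist_factor[OF n])
  moreover have "factor x 0 (L n (x 0)) = iter n [x 0]"
    using block_start_iterate[OF pos, of n] block_start_pow_0[OF pos, of n]
    unfolding block_start_def by metis
  ultimately show ?thesis using x0 by auto
qed

text \<open>The image under \<open>iter n\<close> of the two letters around 0 is a window of
  \<open>x\<close> growing on both sides of 0. Admissibility puts these two letters, and with them
  the window, into an iterate of a single letter.\<close>

lemma two_sided_factor: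
  fixes x :: "int \<Rightarrow> 'a"
  assumes x: "fixed_point A \<phi> x" and adm: "admissible A \<phi> x" and two: "\<exists>a\<in>A. \<exists>b\<in>A. a \<noteq> b"
  shows "\<exists>b\<in>A. \<exists>n. sublist (factor x i d) (iter n [b])"
proof -
  have xA: "x j \<in> A" for j using x unfolding fixed_point_def by auto
  obtain pos where pos: "block_start \<phi> x x pos"
    using x subst_seq_imp_block_start unfolding fixed_point_def by blast
  obtain n where n: "\<And>c. c \<in> A \<Longrightarrow> nat \<bar>i\<bar> + d \<le> L n c"
    using two L_unbounded[of _ _ "nat \<bar>i\<bar> + d"] by blast
  note B = block_start_iterate[OF pos, of n]
  define l r where "l = L n (x (-1))" and "r = L n (x 0)"
  have start: "(pos ^^ n) (-1) = - int l"
  proof -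
    have "(pos ^^ n) (-1 + 1) = (pos ^^ n) (-1) + int l"
      using B unfolding block_start_def l_def by blast
    then show ?thesis using block_start_pow_0[OF pos, of n] by simp
  qed
  have two: "factor x (-1) 2 = [x (-1), x 0]" by (simp add: factor_def upt_rec)
  then have "iter n (factor x (-1) 2) = iter n [x (-1)] @ iter n [x 0]"
    using subst_word_pow_append[of n \<phi> "[x (-1)]" "[x 0]"] by simp
  then have len: "length (iter n (factor x (-1) 2)) = l + r" by (simp add: l_def r_def)
  define m where "m = nat (i + int l)"
  have il: "nat \<bar>i\<bar> + d \<le> l" and ir: "nat \<bar>i\<bar> + d \<le> r" using n[OF xA] by (simp_all add: l_def r_def)
  have "sublist (factor x (- int l + int m) d) (factor x (- int l) (l + r))"
    by (rule sublist_factor) (use il ir in \<open>simp add: m_def\<close>)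
  moreover have "- int l + int m = i" using il by (simp add: m_def)
  moreover have "factor x (- int l) (l + r) = iter n [x (-1), x 0]"
    using block_start_factor[OF B, of "-1" 2] len
    unfolding subst_word_pow_eq_concat[symmetric] start two by simp
  moreover obtain b n' where b: "b \<in> A" "sublist [x (-1), x 0] (iter n' [b])"
    using adm unfolding admissible_def by blast
  then have "sublist (iter n [x (-1), x 0]) (iter (n + n') [b])"
    unfolding subst_word_pow_add by (intro sublist_subst_word_pow)
  ultimately show ?thesis using b(1) sublist_order.order_trans by metis
qed

end

text \<open>The hypothesis \<open>factors\<close> is conditional on primitivity and on two distinct
  letters because both are derived inside the proof; each kind of sequence then supplies it by its
  own lemma.\<close>

lemma automatic_iff_left_eigenvector:
  fixes x :: "'i :: discrete_index \<Rightarrow> 'a"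
  assumes ls: "distinct ls" "set ls = A" and subst: "substitution A \<phi>" and prim: "primitive ls \<phi>"
    and lp: "left_proper A \<phi>" and x: "fixed_point A \<phi> x"
    and factors: "\<And>i d. primitive_substitution A \<phi> \<Longrightarrow> \<exists>a\<in>A. \<exists>b\<in>A. a \<noteq> b \<Longrightarrow>
      \<exists>b\<in>A. \<exists>n. sublist (factor x i d) ((subst_word \<phi> ^^ n) [b])"
    and y: "\<not> periodic (\<tau> \<circ> x)"
  shows "automatic (\<tau> \<circ> x) \<longleftrightarrow> left_eigenvector (incidence_mat ls \<phi>)
    (length_vec ls \<phi> (max_jordan_block (incidence_mat ls \<phi>) 0) :: complex vec)"
proof -
  have xA: "x i \<in> A" for i using x unfolding fixed_point_def by auto
  obtain c where c: "\<And>b. b \<in> A \<Longrightarrow> \<phi> b \<noteq> [] \<and> hd (\<phi> b) = c"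
    using lp unfolding left_proper_def by blast
  have subst': "substitution (set ls) \<phi>" using subst ls(2) by simp
  have ps: "primitive_substitution A \<phi>"
  proof
    show "finite A" using ls(2) by auto
    show "A \<noteq> {}" using xA by auto
    show "set (\<phi> a) \<subseteq> A" if "a \<in> A" for a using subst that by (auto simp: substitution_def)
    show "\<phi> a \<noteq> []" if "a \<in> A" for a using c that by blast
    show "\<exists>n\<ge>1. \<forall>a\<in>A. A \<subseteq> set ((subst_word \<phi> ^^ n) [a])"
      using primitive_imp_all_letters[OF ls(1) subst' prim] ls(2) by simp
  qed
  have two: "\<exists>a\<in>A. \<exists>b\<in>A. a \<noteq> b" using not_periodic_two_letters[OF y] xA by blast
  obtain pos where pos: "block_start \<phi> x x pos"
    using x subst_seq_imp_block_start unfolding fixed_point_def by blast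
  interpret primitive_substitution A \<phi> by (rule ps)
  interpret primitive_fixed_point A \<phi> x pos
    by standard (use xA pos factors[OF ps two] in auto)
  have ne: "ls \<noteq> []" "\<forall>a\<in>set ls. \<phi> a \<noteq> []" using xA c ls(2) by auto
  show ?thesis
  proof
    assume "automatic (\<tau> \<circ> x)"
    then obtain k where k: "k \<ge> 2" "k_automatic k (\<tau> \<circ> x)" unfolding automatic_def by blast
    obtain n where "\<forall>a\<in>A. \<forall>b\<in>A. L (Suc n) a * L n b = L (Suc n) b * L n a"
      using k_automatic_imp_proportional[OF y k(2,1)] c by blast
    then show "left_eigenvector (incidence_mat ls \<phi>)
        (length_vec ls \<phi> (max_jordan_block (incidence_mat ls \<phi>) 0) :: complex vec)"
      using left_eigenvector_length_vec_iff(2)[OF ls(1) subst' ne refl, of n] unfolding ls(2) by blast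
  next
    let ?s = "max_jordan_block (incidence_mat ls \<phi>) 0"
    assume "left_eigenvector (incidence_mat ls \<phi>) (length_vec ls \<phi> ?s :: complex vec)"
    then have "\<And>a b. a \<in> A \<Longrightarrow> b \<in> A \<Longrightarrow> L (Suc ?s) a * L ?s b = L (Suc ?s) b * L ?s a"
      using left_eigenvector_length_vec_iff(1)[OF ls(1) subst' ne refl] unfolding ls(2) by blast
    then obtain k where k: "k \<ge> 2" "\<And>a. a \<in> A \<Longrightarrow> L (Suc ?s) a = k * L ?s a"
      using proportional_imp_constant_ratio[OF two] by blast
    then have "k_automatic k (\<tau> \<circ> x)"
      by (intro constant_ratio_imp_k_automatic[OF x, of k ?s \<tau>]) simp_all
    then show "automatic (\<tau> \<circ> x)" using k(1) unfolding automatic_def by blast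
  qed
qed

theorem corollary1p1:
  fixes A :: "'a set" and B :: "'b set"
    and ls :: "'a list"
    and \<phi> :: "'a \<Rightarrow> 'a list" and \<tau> :: "'a \<Rightarrow> 'b"
    and M :: "complex mat" and s :: nat
  assumes "finite A" and "finite B"
    and "distinct ls" and "set ls = A"
    and "substitution A \<phi>" and "primitive ls \<phi>" and "left_proper A \<phi>"
    and "M = incidence_mat ls \<phi>"
    and "s = max_jordan_block M 0"
    and "\<tau> \<in> A \<rightarrow> B"
  shows "(\<forall>x :: nat \<Rightarrow> 'a. fixed_point A \<phi> x \<and> \<not> periodic (\<tau> \<circ> x) \<longrightarrow>
            (automatic (\<tau> \<circ> x) \<longleftrightarrow> left_eigenvector M (length_vec ls \<phi> s)))
       \<and> (\<forall>x :: int \<Rightarrow> 'a. fixed_point A \<phi> x \<and> admissible A \<phi> x \<and> \<not> periodic (\<tau> \<circ> x) \<longrightarrow>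
            (automatic (\<tau> \<circ> x) \<longleftrightarrow> left_eigenvector M (length_vec ls \<phi> s)))"
proof (intro conjI allI impI)
  fix x :: "nat \<Rightarrow> 'a"
  assume x: "fixed_point A \<phi> x \<and> \<not> periodic (\<tau> \<circ> x)"
  show "automatic (\<tau> \<circ> x) \<longleftrightarrow> left_eigenvector M (length_vec ls \<phi> s)"
    unfolding assms(8,9)
    using x primitive_substitution.one_sided_factor[OF _ conjunct1[OF x]]
    by (intro automatic_iff_left_eigenvector[OF assms(3-7)]) blast+
next
  fix x :: "int \<Rightarrow> 'a"
  assume x: "fixed_point A \<phi> x \<and> admissible A \<phi> x \<and> \<not> periodic (\<tau> \<circ> x)"
  show "automatic (\<tau> \<circ> x) \<longleftrightarrow> left_eigenvector M (length_vec ls \<phi> s)"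
    unfolding assms(8,9)
    using x primitive_substitution.two_sided_factor[OF _ conjunct1[OF x] conjunct1[OF conjunct2[OF x]]]
    by (intro automatic_iff_left_eigenvector[OF assms(3-7)]) blast+
qed

end
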